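(* Let $n\ge2$, $m\ge1$, $q=2^m$, and let $\mathbf{H}_X^{(q)}$, $\mathbf{H}_Z^{(q)}$ be $q$-ary labelings of the toric Tanner graphs $\mathcal{G}_X$, $\mathcal{G}_Z$ (as in the context) with codes $\mathcal{C}_X^{(q)}$, $\mathcal{C}_Z^{(q)}$, such that every cycle of the labeled graph $\mathcal{G}_X$ has product $1$ and $(\mathcal{C}_Z^{(q)})^\perp\subset\mathcal{C}_X^{(q)}$. Then the extended toric code $(\hat{\mathcal{C}}_X,\hat{\mathcal{C}}_Z)$ has quantum dimension $2m$, i.e. $\dim\hat{\mathcal{C}}_X-\dim\hat{\mathcal{C}}_Z^\perp=2m$.
   Context: Indices are taken in $\mathbb{Z}_{2n}=\{0,\dots,2n-1\}$ with arithmetic mod $2n$. Variable nodes: $V=\{(i,j)\in\mathbb{Z}_{2n}^2: i+j\text{ even}\}$ ($2n^2$ nodes). $X$-checks: $C_X=\{(i,j): i\text{ odd}, j\text{ even}\}$; $Z$-checks: $C_Z=\{(i,j): i\text{ even}, j\text{ odd}\}$. Each check $(i,j)$ is adjacent to the variable nodes $(i\pm1,j)$, $(i,j\pm1)$; $\mathcal{G}_X$, $\mathcal{G}_Z$ are the bipartite graphs on $V\cup C_X$, $V\cup C_Z$. A $q$-ary labeling is $\mathbf{H}_X^{(q)}=(x_{c,v})\in\mathbb{F}_q^{C_X\times V}$ with $x_{c,v}\ne0$ iff $c,v$ adjacent, similarly $\mathbf{H}_Z^{(q)}\in\mathbb{F}_q^{C_Z\times V}$; $\mathcal{C}_X^{(q)}=\ker\mathbf{H}_X^{(q)}$,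 $\mathcal{C}_Z^{(q)}=\ker\mathbf{H}_Z^{(q)}$, $\perp$ w.r.t. the standard bilinear form. For a cycle $v_1,c_1,\dots,v_k,c_k,v_1$ of labeled $\mathcal{G}_X$ its product is $\prod_t x_{c_t v_{t+1}}x_{c_t v_t}^{-1}$. Extended toric code: fix an $\mathbb{F}_2$-basis of $\mathbb{F}_{2^m}$ and let $A:\mathbb{F}_{2^m}\to\mathbb{F}_2^{m\times m}$ send $a$ to the matrix of multiplication by $a$ in that basis (an injective ring homomorphism). $\hat{\mathbf{H}}_X$ is the binary matrix obtained from $\mathbf{H}_X^{(q)}$ by replacing each entry $h$ by the $m\times m$ block $A(h)$, and $\hat{\mathbf{H}}_Z$ is obtained from $\mathbf{H}_Z^{(q)}$ by replacing each entry $h$ by $A(h)^T$ (zero entries become zero blocks); then $\hat{\mathbf{H}}_X\hat{\mathbf{H}}_Z^T=0$. $\hat{\mathcal{C}}_X=\ker\hat{\mathbf{H}}_X$, $\hat{\mathcal{C}}_Z=\ker\hat{\mathbf{H}}_Z\subset\mathbb{F}_2^{2mn^2}$, with $\perp$ the standard binary dual; the quantum dimension of the CSS code $(\hat{\mathcal{C}}_X,\hat{\mathcal{C}}_Z)$ is $\dim\hat{\mathcal{C}}_X-\dim\hat{\mathcal{C}}_Z^\perp$. *)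

theory Defs
  imports Main "HOL.Vector_Spaces" "HOL-Library.Z2" "HOL-Library.Function_Algebras"
begin

type_synonym pt = "nat \<times> nat"

text \<open>Indices are taken in Z_{2n} = {0,...,2n-1}, arithmetic mod 2n.\<close>

definition grid :: "nat \<Rightarrow> pt set" where
  "grid n = {0..<2*n} \<times> {0..<2*n}"

definition Vnodes :: "nat \<Rightarrow> pt set" where
  "Vnodes n = {(i,j) \<in> grid n. even (i + j)}"

definition CXnodes :: "nat \<Rightarrow> pt set" where
  "CXnodes n = {(i,j) \<in> grid n. odd i \<and> even j}"

definition CZnodes :: "nat \<Rightarrow> pt set" where
  "CZnodes n = {(i,j) \<in> grid n. even i \<and> odd j}"

definition nbrs :: "nat \<Rightarrow> pt \<Rightarrow> pt set" where
  "nbrs n c = (case c of (i,j) \<Rightarrow>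
     {((i + 1) mod (2*n), j), ((i + 2*n - 1) mod (2*n), j),
      (i, (j + 1) mod (2*n)), (i, (j + 2*n - 1) mod (2*n))})"

definition adj :: "nat \<Rightarrow> pt \<Rightarrow> pt \<Rightarrow> bool" where
  "adj n c v \<longleftrightarrow> v \<in> nbrs n c"

text \<open>A q-ary labeling of the Tanner graph on V \<union> C: a matrix C \<times> V \<rightarrow> F_q
  with x_{c,v} \<noteq> 0 iff c,v adjacent (entries outside C \<times> V are irrelevant).\<close>
definition is_labeling :: "nat \<Rightarrow> pt set \<Rightarrow> (pt \<Rightarrow> pt \<Rightarrow> 'a::field) \<Rightarrow> bool" where
  "is_labeling n C H \<longleftrightarrow> (\<forall>c\<in>C. \<forall>v\<in>Vnodes n. H c v \<noteq> 0 \<longleftrightarrow> adj n c v)"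

text \<open>Vectors in K^I for a finite index set I: functions vanishing outside I.\<close>
definition vecs :: "'i set \<Rightarrow> ('i \<Rightarrow> 'k::zero) set" where
  "vecs I = {x. \<forall>i. i \<notin> I \<longrightarrow> x i = 0}"

definition ker :: "'r set \<Rightarrow> 'i set \<Rightarrow> ('r \<Rightarrow> 'i \<Rightarrow> 'k::field) \<Rightarrow> ('i \<Rightarrow> 'k) set" where
  "ker R I H = {x \<in> vecs I. \<forall>r\<in>R. (\<Sum>i\<in>I. H r i * x i) = 0}"

definition dual :: "'i set \<Rightarrow> ('i \<Rightarrow> 'k::field) set \<Rightarrow> ('i \<Rightarrow> 'k) set" where
  "dual I S = {y \<in> vecs I. \<forall>x\<in>S. (\<Sum>i\<in>I. x i * y i) = 0}"

text \<open>Cycle v_1,c_1,...,v_k,c_k,v_1 of the bipartite graph on V \<union> C (0-indexed lists,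
  distinct vertices, c_t adjacent to v_t and v_{t+1}) and its product.\<close>
definition is_cycle :: "nat \<Rightarrow> pt set \<Rightarrow> pt list \<Rightarrow> pt list \<Rightarrow> bool" where
  "is_cycle n C vs cs \<longleftrightarrow> length vs = length cs \<and> length vs \<ge> 1 \<and>
     distinct vs \<and> distinct cs \<and> set vs \<subseteq> Vnodes n \<and> set cs \<subseteq> C \<and>
     (\<forall>t < length vs. adj n (cs ! t) (vs ! t) \<and>
                      adj n (cs ! t) (vs ! ((t + 1) mod length vs)))"

definition cycle_prod :: "(pt \<Rightarrow> pt \<Rightarrow> 'a::field) \<Rightarrow> pt list \<Rightarrow> pt list \<Rightarrow> 'a" where
  "cycle_prod H vs cs = (\<Prod>t<length vs.
      H (cs ! t) (vs ! ((t + 1) mod length vs)) * inverse (H (cs ! t) (vs ! t)))"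

text \<open>An F_2-basis b_0,...,b_{m-1} of the field 'a (of characteristic 2): every element
  is uniquely a sum of a subset of the basis.\<close>
definition is_F2_basis :: "nat \<Rightarrow> (nat \<Rightarrow> 'a::field) \<Rightarrow> bool" where
  "is_F2_basis m b \<longleftrightarrow> bij_betw (\<lambda>S. \<Sum>i\<in>S. b i) (Pow {..<m}) UNIV"

definition coords :: "nat \<Rightarrow> (nat \<Rightarrow> 'a::field) \<Rightarrow> 'a \<Rightarrow> nat set" where
  "coords m b x = (THE S. S \<subseteq> {..<m} \<and> (\<Sum>i\<in>S. b i) = x)"

definition mulmat :: "nat \<Rightarrow> (nat \<Rightarrow> 'a::field) \<Rightarrow> 'a \<Rightarrow> nat \<Rightarrow> nat \<Rightarrow> bit" where
  "mulmat m b a r s = (if r \<in> coords m b (a * b s) then 1 else 0)"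

definition extX :: "nat \<Rightarrow> (nat \<Rightarrow> 'a::field) \<Rightarrow> (pt \<Rightarrow> pt \<Rightarrow> 'a)
    \<Rightarrow> (pt \<times> nat) \<Rightarrow> (pt \<times> nat) \<Rightarrow> bit" where
  "extX m b H = (\<lambda>(c,r) (v,s). mulmat m b (H c v) r s)"

definition extZ :: "nat \<Rightarrow> (nat \<Rightarrow> 'a::field) \<Rightarrow> (pt \<Rightarrow> pt \<Rightarrow> 'a)
    \<Rightarrow> (pt \<times> nat) \<Rightarrow> (pt \<times> nat) \<Rightarrow> bit" where
  "extZ m b H = (\<lambda>(c,r) (v,s). mulmat m b (H c v) s r)"

definition dimF2 :: "('i \<Rightarrow> bit) set \<Rightarrow> nat" where
  "dimF2 S = vector_space.dim (\<lambda>(c::bit) f i. c * f i) S"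

end

theory Submission
  imports Defs "HOL-Library.FuncSet"
begin

text \<open>
  Regard the X-checks as the vertices and the variables as the edges of an n \<times> n toric grid.
  Since all cycle products are 1, there are nonzero scalars g and f with x(c,v) = g(c) f(v) on all
  adjacent pairs: a potential along the grid, which is well defined because the products around
  faces and around the two kinds of closed grid lines are 1. A Z-check d and a diagonally
  neighbouring X-check share exactly two variables v and w, so orthogonality in characteristic 2
  reads z(d,v) f(v) = z(d,w) f(w); hence z(d,v) = g'(d) / f(v) for some g'. Up to invertible
  diagonal factors both matrices are therefore 0/1 incidence matrices of connected graphs, and each
  has a one-dimensional left kernel, that is, rank n^2 - 1.

  Grouping bits into blocks of length m identifies the kernel of the extended X-matrix with the kernel
  of the q-ary one, and, because of the transposes A(h)^T, the row space of the extended Z-matrix with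
  the row space of the q-ary one. All spaces are finite, so dimensions are computed by counting:
  m (n^2 + 1) - m (n^2 - 1) = 2m.
\<close>

section \<open>Counting in finite vector spaces\<close>

interpretation fun_vs: vector_space "\<lambda>(c::'k::field) (f::'i \<Rightarrow> 'k) i. c * f i"
  by unfold_locales (auto simp: fun_eq_iff algebra_simps)

text \<open>Every nonempty fibre is a translate of the kernel, so all fibres over the image have
  equal size. Closure under differences already yields 0, negatives and sums.\<close>

lemma card_image_times_card_kernel:
  fixes f :: "'a::ab_group_add \<Rightarrow> 'b::ab_group_add"
  assumes fin: "finite S"
    and diff: "\<And>x y. x \<in> S \<Longrightarrow> y \<in> S \<Longrightarrow> x - y \<in> S"
    and hom: "\<And>x y. x \<in> S \<Longrightarrow> y \<in> S \<Longrightarrow> f (x - y) = f x - f y"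
  shows "card (f ` S) * card {x \<in> S. f x = 0} = card S"
proof -
  have fibre: "card {x \<in> S. f x = y} = card {x \<in> S. f x = 0}" if y: "y \<in> f ` S" for y
  proof -
    from y obtain x0 where x0: "x0 \<in> S" "y = f x0" by auto
    have z: "0 \<in> S" using diff[OF x0(1) x0(1)] by simp
    have add: "x + x0 \<in> S \<and> f (x + x0) = f x + f x0" if "x \<in> S" for x
    proof -
      have n: "- x0 \<in> S" "f (- x0) = - f x0"
        using diff[OF z x0(1)] hom[OF z x0(1)] hom[OF z z] by auto
      show ?thesis using diff[OF that n(1)] hom[OF that n(1)] n(2) by auto
    qed
    have "bij_betw (\<lambda>x. x - x0) {x \<in> S. f x = y} {x \<in> S. f x = 0}"
      by (rule bij_betw_byWitness[where f' = "\<lambda>x. x + x0"])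
        (auto simp: x0 diff hom add)
    then show ?thesis by (rule bij_betw_same_card)
  qed
  have "card S = (\<Sum>y \<in> f ` S. card {x \<in> S. f x = y})"
    using sum.image_gen[OF fin, of "\<lambda>_. 1::nat" f] by simp
  also have "\<dots> = card (f ` S) * card {x \<in> S. f x = 0}"
    using fibre by simp
  finally show ?thesis by simp
qed

lemma card_vecs:
  assumes "finite I"
  shows "card (vecs I :: ('i \<Rightarrow> 'k::{zero,finite}) set) = card (UNIV :: 'k set) ^ card I"
    and "finite (vecs I :: ('i \<Rightarrow> 'k) set)"
proof -
  have bij: "bij_betw (\<lambda>x. restrict x I) (vecs I :: ('i \<Rightarrow> 'k) set) (I \<rightarrow>\<^sub>E UNIV)"
    by (rule bij_betw_byWitness[where f' = "\<lambda>x i. if i \<in> I then x i else 0"])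
      (auto simp: vecs_def fun_eq_iff PiE_def extensional_def)
  have fin: "finite (I \<rightarrow>\<^sub>E (UNIV :: 'k set))"
    using assms by (intro finite_PiE) auto
  show "finite (vecs I :: ('i \<Rightarrow> 'k) set)"
    using bij_betw_finite[OF bij] fin by simp
  show "card (vecs I :: ('i \<Rightarrow> 'k) set) = card (UNIV :: 'k set) ^ card I"
    using bij_betw_same_card[OF bij] assms by (simp add: card_PiE)
qed

lemma subspace_vecs: "fun_vs.subspace (vecs I)"
  by (auto simp: fun_vs.subspace_def vecs_def)

lemma subspace_ker: "fun_vs.subspace (ker R I H)"
  unfolding fun_vs.subspace_def ker_def vecs_def
  by (auto simp: algebra_simps sum.distrib simp flip: sum_distrib_left)

lemma subspace_dual: "fun_vs.subspace (dual I S)"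
  unfolding fun_vs.subspace_def dual_def vecs_def
  by (auto simp: algebra_simps sum.distrib simp flip: sum_distrib_left)

text \<open>A functional that is nonzero at \<open>s\<close> is onto, since the multiples of
  \<open>s\<close> reach every value; hence its kernel has index q.\<close>

lemma card_kernel_functional:
  fixes f :: "('i \<Rightarrow> 'k::{field,finite}) \<Rightarrow> 'k"
  assumes "finite S" and S: "fun_vs.subspace S"
    and diff: "\<And>x y. f (x - y) = f x - f y"
    and scale: "\<And>c x. f (\<lambda>i. c * x i) = c * f x"
    and nz: "s \<in> S" "f s \<noteq> 0"
  shows "card (UNIV :: 'k set) * card {x \<in> S. f x = 0} = card S"
proof -
  have "y \<in> f ` S" for y
  proof -
    have "f (\<lambda>i. (y / f s) * s i) = y" unfolding scale using nz by simp
    moreover have "(\<lambda>i. (y / f s) * s i) \<in> S"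
      using fun_vs.subspace_scale[OF S nz(1)] .
    ultimately show ?thesis by (metis imageI)
  qed
  then have "f ` S = UNIV" by auto
  then show ?thesis
    using card_image_times_card_kernel[of S f] assms fun_vs.subspace_diff[OF S] by simp
qed

text \<open>Double counting of the orthogonal pairs in S \<times> K^I: a nonzero functional vanishes on
  exactly a fraction 1/q of its domain.\<close>
lemma card_subspace_times_card_dual:
  fixes S :: "('i \<Rightarrow> 'k::{field,finite}) set"
  assumes I: "finite I" and S: "fun_vs.subspace S" and sub: "S \<subseteq> vecs I"
  shows "card S * card (dual I S) = card (UNIV :: 'k set) ^ card I"
proof -
  let ?W = "vecs I :: ('i \<Rightarrow> 'k) set" and ?D = "dual I S"
  let ?q = "card (UNIV :: 'k set)"
  let ?f = "\<lambda>x y. \<Sum>i\<in>I. x i * y i :: 'k"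
  have W: "finite ?W" "card ?W = ?q ^ card I" using card_vecs[OF I, where 'k='k] by auto
  have finS: "finite S" using W sub finite_subset by blast
  have D: "?D \<subseteq> ?W" by (auto simp: dual_def)
  have finD: "finite ?D" using W D finite_subset by blast
  have zS: "0 \<in> S" using fun_vs.subspace_0[OF S] .
  have lin: "?f x (y - z) = ?f x y - ?f x z" "?f (x - y) z = ?f x z - ?f y z"
    "?f x (\<lambda>i. c * y i) = c * ?f x y" "?f (\<lambda>i. c * x i) y = c * ?f x y" for x y z c
    by (simp_all add: algebra_simps sum_subtractf sum_distrib_left)
  \<comment> \<open>The factor \<open>?q\<close> avoids division. For nonzero \<open>x\<close> the
    functional is witnessed to be nonzero by the unit vector at a coordinate where \<open>x\<close>
    does not vanish.\<close>
  have row: "?q * card {y \<in> ?W. ?f x y = 0} = (if x = 0 then ?q * card ?W else card ?W)"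
    if x: "x \<in> S" for x
  proof (cases "x = 0")
    case False
    then obtain i where i: "x i \<noteq> 0" by (auto simp: fun_eq_iff)
    then have iI: "i \<in> I" using x sub by (auto simp: vecs_def)
    let ?e = "\<lambda>j. if j = i then 1 else 0 :: 'k"
    have "?f x ?e = (\<Sum>j\<in>I. if j = i then x j else 0)" by (intro sum.cong) auto
    then have "?f x ?e \<noteq> 0" using i iI I by simp
    moreover have "?e \<in> ?W" using iI by (auto simp: vecs_def)
    ultimately show ?thesis
      using card_kernel_functional[OF W(1) subspace_vecs, of "?f x" ?e] lin False by simp
  qed simp
  have col: "?q * card {x \<in> S. ?f x y = 0} = (if y \<in> ?D then ?q * card S else card S)"
    if y: "y \<in> ?W" for y
  proof (cases "y \<in> ?D")
    case True
    then have "{x \<in> S. ?f x y = 0} = S" by (auto simp: dual_def)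
    then show ?thesis using True by simp
  next
    case False
    then obtain x where "x \<in> S" "?f x y \<noteq> 0" using y by (auto simp: dual_def)
    then show ?thesis
      using card_kernel_functional[OF finS S, of "\<lambda>x. ?f x y" x] lin False by simp
  qed
  have "(\<Sum>x\<in>S. card {y \<in> ?W. ?f x y = 0}) = (\<Sum>x\<in>S. \<Sum>y\<in>?W. if ?f x y = 0 then 1 else 0)"
    using W(1) by (simp add: sum.If_cases Int_def)
  also have "\<dots> = (\<Sum>y\<in>?W. \<Sum>x\<in>S. if ?f x y = 0 then 1 else 0)" by (rule sum.swap)
  also have "\<dots> = (\<Sum>y\<in>?W. card {x \<in> S. ?f x y = 0})"
    using finS by (simp add: sum.If_cases Int_def)
  finally have "(\<Sum>x\<in>S. ?q * card {y \<in> ?W. ?f x y = 0}) = (\<Sum>y\<in>?W. ?q * card {x \<in> S. ?f x y = 0})"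
    by (simp flip: sum_distrib_left)
  then have "(\<Sum>x\<in>S. if x = 0 then ?q * card ?W else card ?W)
      = (\<Sum>y\<in>?W. if y \<in> ?D then ?q * card S else card S)"
    by (simp add: row col cong: sum.cong)
  moreover have "{x \<in> S. x = 0} = {0}" "S \<inter> - {0} = S - {0}" "?W \<inter> ?D = ?D" "?W \<inter> - ?D = ?W - ?D"
    using zS D by auto
  \<comment> \<open>The vector \<open>x = 0\<close> is split off on the left, the members of the
    dual on the right.\<close>
  ultimately have eq: "?q * card ?W + (card S - 1) * card ?W
      = card ?D * (?q * card S) + (card ?W - card ?D) * card S"
    using finS W(1) zS finD D by (simp add: sum.If_cases Int_def card_Diff_subset)
  have "card S \<ge> 1" using zS finS by (metis One_nat_def Suc_leI card_gt_0_iff empty_iff)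
  moreover have "card ?D \<le> card ?W" using D W(1) card_mono by blast
  ultimately have "int (card S - 1) = int (card S) - 1" "int (card ?W - card ?D) = int (card ?W) - int (card ?D)"
    by (simp_all only: of_nat_diff of_nat_1)
  then have "int ?q * int (card ?W) + (int (card S) - 1) * int (card ?W)
      = int (card ?D) * (int ?q * int (card S)) + (int (card ?W) - int (card ?D)) * int (card S)"
    using arg_cong[OF eq, of int] by (simp only: of_nat_add of_nat_mult)
  \<comment> \<open>Over the integers the common term |S| |W| cancels; q - 1 can then be divided out
    because 0 and 1 differ.\<close>
  then have "(int ?q - 1) * (int (card S) * int (card ?D)) = (int ?q - 1) * int (card ?W)"
    by (simp add: algebra_simps)
  moreover have "?q \<ge> card {0, 1 :: 'k}" by (intro card_mono) auto
  ultimately have "int (card S * card ?D) = int (card ?W)" by simp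
  then show ?thesis using W(2) by (metis of_nat_eq_iff)
qed

section \<open>Row spaces, kernels and their duality\<close>

definition row_comb :: "'r set \<Rightarrow> 'i set \<Rightarrow> ('r \<Rightarrow> 'i \<Rightarrow> 'k::field) \<Rightarrow> ('r \<Rightarrow> 'k) \<Rightarrow> 'i \<Rightarrow> 'k" where
  "row_comb R I H u = (\<lambda>i. if i \<in> I then \<Sum>r\<in>R. u r * H r i else 0)"

text \<open>Coefficients come from \<open>vecs R\<close>, a finite space when \<open>R\<close> and
  the field are finite, so the image can be counted against the left kernel.\<close>

definition row_space :: "'r set \<Rightarrow> 'i set \<Rightarrow> ('r \<Rightarrow> 'i \<Rightarrow> 'k::field) \<Rightarrow> ('i \<Rightarrow> 'k) set" where
  "row_space R I H = row_comb R I H ` vecs R"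

lemma row_comb_linear:
  "row_comb R I H (x + y) = row_comb R I H x + row_comb R I H y"
  "row_comb R I H (x - y) = row_comb R I H x - row_comb R I H y"
  "row_comb R I H (\<lambda>r. c * x r) = (\<lambda>i. c * row_comb R I H x i)"
  by (auto simp: row_comb_def fun_eq_iff algebra_simps sum.distrib sum_subtractf sum_distrib_left)

lemma row_space_subset: "row_space R I H \<subseteq> vecs I"
  by (auto simp: row_space_def row_comb_def vecs_def)

lemma subspace_row_space: "fun_vs.subspace (row_space R I H)"
  unfolding row_space_def
proof (rule fun_vs.subspaceI)
  have "row_comb R I H 0 = 0" by (auto simp: row_comb_def)
  then show "0 \<in> row_comb R I H ` vecs R"
    using imageI[OF fun_vs.subspace_0[OF subspace_vecs[of R]], of "row_comb R I H"] by simp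
next
  fix x y assume "x \<in> row_comb R I H ` vecs R" "y \<in> row_comb R I H ` vecs R"
  then obtain u v where "x = row_comb R I H u" "y = row_comb R I H v" and uv: "u \<in> vecs R" "v \<in> vecs R"
    by blast
  then have "x + y = row_comb R I H (u + v)" by (simp add: row_comb_linear)
  then show "x + y \<in> row_comb R I H ` vecs R"
    using fun_vs.subspace_add[OF subspace_vecs uv] by (rule image_eqI)
next
  fix c x assume "x \<in> row_comb R I H ` vecs R"
  then obtain u where "x = row_comb R I H u" and u: "u \<in> vecs R" by blast
  then have "(\<lambda>i. c * x i) = row_comb R I H (\<lambda>r. c * u r)" by (simp add: row_comb_linear)
  then show "(\<lambda>i. c * x i) \<in> row_comb R I H ` vecs R"
    using fun_vs.subspace_scale[OF subspace_vecs u] by (rule image_eqI)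
qed

lemma row_comb_dot:
  assumes "finite R"
  shows "(\<Sum>i\<in>I. row_comb R I H u i * x i) = (\<Sum>r\<in>R. u r * (\<Sum>i\<in>I. H r i * x i))"
proof -
  have "(\<Sum>i\<in>I. row_comb R I H u i * x i) = (\<Sum>i\<in>I. \<Sum>r\<in>R. u r * H r i * x i)"
    by (simp add: row_comb_def sum_distrib_right cong: sum.cong)
  also have "\<dots> = (\<Sum>r\<in>R. \<Sum>i\<in>I. u r * H r i * x i)" by (rule sum.swap)
  finally show ?thesis by (simp add: sum_distrib_left mult.assoc)
qed

lemma row_in_row_space:
  assumes "finite R" "r \<in> R"
  shows "(\<lambda>i. if i \<in> I then H r i else 0) \<in> row_space R I H"
proof -
  let ?e = "\<lambda>r'. if r' = r then 1 else 0"
  have "(\<Sum>r'\<in>R. ?e r' * H r' i) = (\<Sum>r'\<in>R. if r' = r then H r' i else 0)" for i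
    by (intro sum.cong) auto
  then have "(\<lambda>i. if i \<in> I then H r i else 0) = row_comb R I H ?e"
    using assms by (intro ext) (simp only: row_comb_def sum.delta if_True)
  moreover have "?e \<in> vecs R" using assms by (auto simp: vecs_def)
  ultimately show ?thesis unfolding row_space_def by (rule image_eqI)
qed

text \<open>Orthogonality to all combinations reduces to orthogonality to the single rows, and that
  is the kernel condition.\<close>

lemma dual_row_space:
  assumes "finite R"
  shows "dual I (row_space R I H) = ker R I H"
proof
  show "ker R I H \<subseteq> dual I (row_space R I H)"
    by (auto simp: ker_def dual_def row_space_def row_comb_dot assms)
  show "dual I (row_space R I H) \<subseteq> ker R I H"
  proof
    fix x assume x: "x \<in> dual I (row_space R I H)"
    have "(\<Sum>i\<in>I. H r i * x i) = 0" if "r \<in> R" for r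
    proof -
      have "(\<Sum>i\<in>I. (if i \<in> I then H r i else 0) * x i) = 0"
        using bspec[OF conjunct2[OF x[unfolded dual_def mem_Collect_eq]]
            row_in_row_space[OF assms that, of I H]] .
      then show ?thesis by (simp cong: sum.cong)
    qed
    with x show "x \<in> ker R I H" by (auto simp: ker_def dual_def)
  qed
qed

lemma row_space_subset_dual_ker:
  assumes "finite R"
  shows "row_space R I H \<subseteq> dual I (ker R I H)"
proof
  fix y assume y: "y \<in> row_space R I H"
  have "(\<Sum>i\<in>I. x i * y i) = 0" if "x \<in> ker R I H" for x
    using that y dual_row_space[OF assms, of I H] by (auto simp: dual_def mult.commute)
  then show "y \<in> dual I (ker R I H)"
    using y row_space_subset[of R I H] by (auto simp: dual_def)
qed

lemma card_row_space_times_card_ker: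
  fixes H :: "'r \<Rightarrow> 'i \<Rightarrow> 'k::{field,finite}"
  assumes "finite R" "finite I"
  shows "card (row_space R I H) * card (ker R I H) = card (UNIV :: 'k set) ^ card I"
  using card_subspace_times_card_dual[OF assms(2) subspace_row_space row_space_subset[of R I H]]
  unfolding dual_row_space[OF assms(1)] .

text \<open>One inclusion is immediate. Both sides have q^|I| / |ker| elements, which forces
  equality.\<close>

lemma dual_ker:
  fixes H :: "'r \<Rightarrow> 'i \<Rightarrow> 'k::{field,finite}"
  assumes "finite R" "finite I"
  shows "dual I (ker R I H) = row_space R I H"
proof -
  have "ker R I H \<subseteq> vecs I" by (auto simp: ker_def)
  then have 1: "card (ker R I H) * card (dual I (ker R I H)) = card (UNIV :: 'k set) ^ card I"
    using card_subspace_times_card_dual[OF assms(2) subspace_ker] by blast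
  moreover have "card (UNIV :: 'k set) ^ card I > 0" by (simp add: card_gt_0_iff)
  ultimately have "card (dual I (ker R I H)) = card (row_space R I H)"
    using card_row_space_times_card_ker[OF assms, of H]
    by (metis mult.commute mult_cancel1 mult_is_0 neq0_conv)
  moreover have "finite (dual I (ker R I H))"
    using card_vecs(2)[OF assms(2), where 'k='k] by (rule finite_subset[rotated]) (auto simp: dual_def)
  ultimately show ?thesis
    using row_space_subset_dual_ker[OF assms(1), of I H] by (metis card_subset_eq)
qed

text \<open>Rank-nullity for u -> u^T H in counting form; it lets the rank be read off the left
  kernel.\<close>

lemma card_row_space_times_card_left_kernel:
  fixes H :: "'r \<Rightarrow> 'i \<Rightarrow> 'k::{field,finite}"
  assumes "finite R"
  shows "card (row_space R I H) * card {u \<in> vecs R. row_comb R I H u = 0} = card (UNIV :: 'k set) ^ card R"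
  unfolding row_space_def card_vecs(1)[OF assms, where 'k='k, symmetric]
  by (rule card_image_times_card_kernel[OF card_vecs(2)[OF assms]])
    (auto simp: row_comb_linear(2) fun_vs.subspace_diff[OF subspace_vecs])

section \<open>From cardinality to dimension over F_2\<close>

lemma card_span_independent:
  fixes B :: "('i \<Rightarrow> 'k::{field,finite}) set"
  assumes "finite B" "fun_vs.independent B"
  shows "card (fun_vs.span B) = card (UNIV :: 'k set) ^ card B"
  using assms
proof (induction B)
  case (insert a B)
  then have ind: "fun_vs.independent B" and a: "a \<notin> fun_vs.span B"
    by (auto simp: fun_vs.independent_insert)
  \<comment> \<open>Each vector of the larger span is y + k a for exactly one k and one y in
    \<open>?S\<close>, so a new independent vector multiplies the count by q.\<close>
  let ?S = "fun_vs.span B" and ?g = "\<lambda>(k, y). y + (\<lambda>i. k * a i)"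
  have "inj_on ?g (UNIV \<times> ?S)"
  proof (rule inj_onI, clarify)
    fix k y l z assume yz: "y \<in> ?S" "z \<in> ?S"
      and eq: "y + (\<lambda>i. k * a i) = z + (\<lambda>i. l * a i)"
    have p: "y i + k * a i = z i + l * a i" for i
      using fun_cong[OF eq, of i] by simp
    have d: "(\<lambda>i. (k - l) * a i) = z - y"
    proof
      fix i show "(k - l) * a i = (z - y) i" using p[of i] by (simp add: algebra_simps)
    qed
    \<comment> \<open>Otherwise \<open>a\<close> would be a multiple of \<open>z - y\<close> and so
      lie in the span of \<open>B\<close>.\<close>
    have "k = l"
    proof (rule ccontr)
      assume "k \<noteq> l"
      then have "a = (\<lambda>i. inverse (k - l) * ((k - l) * a i))" by (auto simp: fun_eq_iff)
      also have "\<dots> = (\<lambda>i. inverse (k - l) * (z - y) i)" using d by (simp add: fun_eq_iff)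
      also have "\<dots> \<in> ?S" by (intro fun_vs.span_scale fun_vs.span_diff yz)
      finally show False using a by contradiction
    qed
    then show "k = l \<and> y = z" using p by auto
  qed
  moreover have "?g ` (UNIV \<times> ?S) = fun_vs.span (insert a B)"
  proof (intro set_eqI iffI)
    fix x assume "x \<in> ?g ` (UNIV \<times> ?S)"
    then obtain k y where "y \<in> ?S" "x = y + (\<lambda>i. k * a i)" by auto
    then have "x - (\<lambda>i. k * a i) \<in> ?S" by simp
    then show "x \<in> fun_vs.span (insert a B)" using fun_vs.span_breakdown_eq[of x a B] by blast
  next
    fix x assume "x \<in> fun_vs.span (insert a B)"
    then obtain k where k: "x - (\<lambda>i. k * a i) \<in> ?S" using fun_vs.span_breakdown_eq[of x a B] by blast
    then have "x = ?g (k, x - (\<lambda>i. k * a i))" by simp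
    then show "x \<in> ?g ` (UNIV \<times> ?S)" using k by (intro image_eqI) auto
  qed
  ultimately have "card (fun_vs.span (insert a B)) = card (UNIV :: 'k set) * card ?S"
    by (metis card_image card_cartesian_product)
  then show ?case using insert.IH[OF ind] insert.hyps by simp
qed simp

lemma UNIV_bit: "(UNIV :: bit set) = {0, 1}"
  by auto

text \<open>Makes the counting lemmas applicable with F_2 as the field.\<close>

instance bit :: finite
  by standard (simp add: UNIV_bit)

lemma two_power_dimF2:
  assumes "fun_vs.subspace S" "finite S"
  shows "2 ^ dimF2 S = card S"
proof -
  obtain B where B: "B \<subseteq> S" "fun_vs.independent B" "S \<subseteq> fun_vs.span B" "card B = fun_vs.dim S"
    using fun_vs.basis_exists[of S] by blast
  have "fun_vs.span B = S"
    using B fun_vs.span_minimal[OF B(1) assms(1)] by auto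
  then show ?thesis
    using card_span_independent[OF finite_subset[OF B(1) assms(2)] B(2)] B(4)
    unfolding dimF2_def by (simp add: UNIV_bit numeral_2_eq_2)
qed

section \<open>Binary expansion\<close>

text \<open>The shift by 1 permutes the field, so it preserves the sum of all elements; hence the
  number of elements, 2^m, is 0 in the field, and so is 2.\<close>

lemma char_two_of_card:
  assumes "card (UNIV :: 'a::{field,finite} set) = 2 ^ m"
  shows "(1 + 1 :: 'a) = 0"
proof -
  have "(\<Sum>x\<in>UNIV. x) = (\<Sum>x\<in>UNIV. x + 1 :: 'a)"
    by (rule sum.reindex_bij_witness[of _ "\<lambda>x. x + 1" "\<lambda>x. x - 1"]) auto
  also have "\<dots> = (\<Sum>x\<in>UNIV. x) + of_nat (card (UNIV :: 'a set))"
    by (simp add: sum.distrib)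
  finally have "(2 :: 'a) ^ m = 0" by (simp add: assms)
  then show ?thesis by simp
qed

lemma char_two_add_eq_zero_iff:
  fixes x y :: "'a::field"
  assumes "(1 + 1 :: 'a) = 0"
  shows "x + y = 0 \<longleftrightarrow> x = y"
proof -
  have "y + y = (1 + 1) * y" by (simp only: distrib_right mult_1)
  then have "y + y = 0" using assms by simp
  then show ?thesis by (metis add_right_cancel)
qed

text \<open>The map \<open>of_bool (x = 1)\<close> embeds F_2 into a field of characteristic 2 and
  is additive there.\<close>

lemma of_bool_bit_sum:
  fixes f :: "'i \<Rightarrow> bit"
  assumes "(1 + 1 :: 'a::field) = 0"
  shows "of_bool ((\<Sum>i\<in>I. f i) = 1) = (\<Sum>i\<in>I. of_bool (f i = 1) :: 'a)"
proof (induction I rule: infinite_finite_induct)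
  case (insert i I)
  have "of_bool (x + y = 1) = (of_bool (x = 1) + of_bool (y = 1) :: 'a)" for x y :: bit
    using assms by (cases x; cases y) auto
  then show ?case using insert by simp
qed auto

definition bit_comb :: "nat \<Rightarrow> (nat \<Rightarrow> 'a::field) \<Rightarrow> (nat \<Rightarrow> bit) \<Rightarrow> 'a" where
  "bit_comb m b y = (\<Sum>s<m. of_bool (y s = 1) * b s)"

lemma bit_comb_alt: "bit_comb m b y = (\<Sum>s\<in>{s. s < m \<and> y s = 1}. b s)"
  unfolding bit_comb_def
  by (rule sum.mono_neutral_cong_right) auto

lemma bit_comb_cong:
  "(\<And>s. s < m \<Longrightarrow> x s = y s) \<Longrightarrow> bit_comb m b x = bit_comb m b y"
  by (simp add: bit_comb_def)

lemma bit_comb_zero [simp]: "bit_comb m b (\<lambda>s. 0) = 0"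
  by (simp add: bit_comb_def)

text \<open>\<open>is_F2_basis\<close> speaks of subsets of the index set; a bit vector corresponds
  to its support.\<close>

lemma bij_betw_bit_comb:
  assumes "is_F2_basis m b"
  shows "bij_betw (bit_comb m b) (vecs {..<m}) UNIV"
proof -
  have "bij_betw (\<lambda>y. {s. s < m \<and> y s = (1::bit)}) (vecs {..<m}) (Pow {..<m})"
    by (rule bij_betw_byWitness[where f' = "\<lambda>S s. if s \<in> S then 1 else 0"])
      (auto simp: vecs_def fun_eq_iff)
  then have "bij_betw ((\<lambda>S. \<Sum>i\<in>S. b i) \<circ> (\<lambda>y. {s. s < m \<and> y s = (1::bit)})) (vecs {..<m}) UNIV"
    using assms unfolding is_F2_basis_def by (rule bij_betw_trans)
  moreover have "(\<lambda>S. \<Sum>i\<in>S. b i) \<circ> (\<lambda>y. {s. s < m \<and> y s = (1::bit)}) = bit_comb m b"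
    by (simp add: fun_eq_iff bit_comb_alt)
  ultimately show ?thesis by simp
qed

lemma bit_comb_eq_iff:
  assumes "is_F2_basis m b"
  shows "bit_comb m b x = bit_comb m b y \<longleftrightarrow> (\<forall>s<m. x s = y s)"
proof
  assume eq: "bit_comb m b x = bit_comb m b y"
  \<comment> \<open>Injectivity is available on \<open>vecs {..<m}\<close> only, so both vectors are
    first cut to their first \<open>m\<close> bits.\<close>
  let ?t = "\<lambda>x s. if s < m then x s else (0::bit)"
  have "bit_comb m b (?t x) = bit_comb m b (?t y)"
    using eq bit_comb_cong[of m "?t x" x b] bit_comb_cong[of m "?t y" y b] by simp
  moreover have "?t x \<in> vecs {..<m}" "?t y \<in> vecs {..<m}" by (auto simp: vecs_def)
  ultimately have "?t x = ?t y"
    using bij_betw_bit_comb[OF assms] unfolding bij_betw_def inj_on_def by blast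
  then have "?t x s = ?t y s" for s by (rule fun_cong)
  then show "\<forall>s<m. x s = y s" by (metis (full_types))
qed (auto intro: bit_comb_cong)

text \<open>Column \<open>s\<close> of A(a) holds the coordinates of a b_s. The work lies in the
  existence and uniqueness behind the definite description in \<open>coords\<close>.\<close>

lemma bit_comb_mulmat:
  assumes "is_F2_basis m b"
  shows "bit_comb m b (\<lambda>r. mulmat m b a r s) = a * b s"
proof -
  let ?x = "a * b s"
  have inj: "inj_on (\<lambda>S. \<Sum>i\<in>S. b i) (Pow {..<m})" and "?x \<in> (\<lambda>S. \<Sum>i\<in>S. b i) ` Pow {..<m}"
    using assms unfolding is_F2_basis_def bij_betw_def by auto
  then obtain S where S: "S \<subseteq> {..<m}" "(\<Sum>i\<in>S. b i) = ?x" by auto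
  then have "\<exists>!S. S \<subseteq> {..<m} \<and> (\<Sum>i\<in>S. b i) = ?x"
    using inj_onD[OF inj] by (intro ex1I[of _ S]) (simp_all only: Pow_iff)
  from theI'[OF this] have c: "coords m b ?x \<subseteq> {..<m}" "(\<Sum>i\<in>coords m b ?x. b i) = ?x"
    unfolding coords_def by auto
  have "{r. r < m \<and> mulmat m b a r s = 1} = coords m b ?x"
    using c(1) by (auto simp: mulmat_def)
  then show ?thesis using c(2) by (simp add: bit_comb_alt)
qed

text \<open>A block row applied to bits yields the coordinates of the corresponding q-ary sum:
  additivity moves \<open>bit_comb\<close> inside, where it turns each column of A(h v) into h v
  times a basis element.\<close>

lemma bit_comb_block_product:
  assumes basis: "is_F2_basis m b" and char2: "(1 + 1 :: 'a::field) = 0"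
  shows "bit_comb m b (\<lambda>r. \<Sum>(v,s)\<in>V \<times> {..<m}. mulmat m b (h v :: 'a) r s * x (v,s))
    = (\<Sum>v\<in>V. h v * bit_comb m b (\<lambda>s. x (v,s)))"
proof -
  have mul: "of_bool (y * z = 1) = (of_bool (y = 1) * of_bool (z = 1) :: 'a)" for y z :: bit
    by (cases y; cases z) auto
  have "bit_comb m b (\<lambda>r. \<Sum>(v,s)\<in>V \<times> {..<m}. mulmat m b (h v) r s * x (v,s))
     = (\<Sum>r<m. (\<Sum>(v,s)\<in>V \<times> {..<m}. of_bool (mulmat m b (h v) r s = 1) * of_bool (x (v,s) = 1)) * b r)"
    unfolding bit_comb_def of_bool_bit_sum[OF char2] by (simp only: mul split_def)
  also have "\<dots> = (\<Sum>r<m. \<Sum>(v,s)\<in>V \<times> {..<m}.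
      of_bool (x (v,s) = 1) * (of_bool (mulmat m b (h v) r s = 1) * b r))"
    unfolding sum_distrib_right split_def by (simp only: mult_ac)
  also have "\<dots> = (\<Sum>(v,s)\<in>V \<times> {..<m}. \<Sum>r<m.
      of_bool (x (v,s) = 1) * (of_bool (mulmat m b (h v) r s = 1) * b r))"
    unfolding split_def by (rule sum.swap)
  also have "\<dots> = (\<Sum>(v,s)\<in>V \<times> {..<m}. of_bool (x (v,s) = 1) * bit_comb m b (\<lambda>r. mulmat m b (h v) r s))"
    unfolding bit_comb_def by (simp only: sum_distrib_left)
  also have "\<dots> = (\<Sum>v\<in>V. \<Sum>s<m. of_bool (x (v,s) = 1) * (h v * b s))"
    by (simp only: bit_comb_mulmat[OF basis] sum.cartesian_product)
  also have "\<dots> = (\<Sum>v\<in>V. h v * bit_comb m b (\<lambda>s. x (v,s)))"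
    unfolding bit_comb_def sum_distrib_left by (simp only: mult_ac)
  finally show ?thesis .
qed

section \<open>Packing blocks of m bits into field elements\<close>

definition pack :: "nat \<Rightarrow> (nat \<Rightarrow> 'a::field) \<Rightarrow> ('v \<times> nat \<Rightarrow> bit) \<Rightarrow> 'v \<Rightarrow> 'a" where
  "pack m b x = (\<lambda>v. bit_comb m b (\<lambda>s. x (v,s)))"

lemma bij_betw_pack:
  assumes basis: "is_F2_basis m b"
  shows "bij_betw (pack m b) (vecs (V \<times> {..<m})) (vecs V)"
proof (rule bij_betw_imageI)
  show "inj_on (pack m b) (vecs (V \<times> {..<m}))"
  proof (rule inj_onI)
    fix x y :: "'b \<times> nat \<Rightarrow> bit"
    assume x: "x \<in> vecs (V \<times> {..<m})" and y: "y \<in> vecs (V \<times> {..<m})" and eq: "pack m b x = pack m b y"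
    show "x = y"
    proof
      fix p :: "'b \<times> nat"
      obtain v s where p: "p = (v, s)" by (cases p)
      show "x p = y p"
      proof (cases "s < m")
        case True
        then show ?thesis
          using fun_cong[OF eq, of v] bit_comb_eq_iff[OF basis] by (simp add: pack_def p)
      next
        case False
        then show ?thesis using x y by (simp add: vecs_def p)
      qed
    qed
  qed
  show "pack m b ` vecs (V \<times> {..<m}) = vecs V"
  proof (intro set_eqI iffI)
    fix w assume "w \<in> pack m b ` vecs (V \<times> {..<m})"
    then obtain x where x: "x \<in> vecs (V \<times> {..<m})" "w = pack m b x" by blast
    have "w v = 0" if "v \<notin> V" for v
    proof -
      have "(\<lambda>s. x (v,s)) = (\<lambda>s. 0)" using x(1) that by (auto simp: vecs_def)
      then show ?thesis by (simp add: x(2) pack_def)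
    qed
    then show "w \<in> vecs V" by (simp add: vecs_def)
  next
    fix w :: "'b \<Rightarrow> 'a" assume w: "w \<in> vecs V"
    have "\<exists>y. y \<in> vecs {..<m} \<and> bit_comb m b y = a" for a
      using bij_betw_bit_comb[OF basis] unfolding bij_betw_def by (metis UNIV_I imageE)
    then obtain g where g: "\<And>a. g a \<in> vecs {..<m}" "\<And>a. bit_comb m b (g a) = a" by metis
    let ?x = "\<lambda>(v,s). if v \<in> V then g (w v) s else 0"
    have "?x \<in> vecs (V \<times> {..<m})" using g(1) by (auto simp: vecs_def)
    moreover have "w = pack m b ?x"
    proof
      fix v show "w v = pack m b ?x v"
        using w g(2)[of "w v"] by (cases "v \<in> V") (simp_all add: pack_def vecs_def)
    qed
    ultimately show "w \<in> pack m b ` vecs (V \<times> {..<m})" by blast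
  qed
qed

lemma card_ker_extX:
  assumes basis: "is_F2_basis m b" and char2: "(1 + 1 :: 'a::field) = 0"
  shows "card (ker (C \<times> {..<m}) (V \<times> {..<m}) (extX m b H)) = card (ker C V (H :: pt \<Rightarrow> pt \<Rightarrow> 'a))"
proof -
  have ball_prod: "(\<forall>p\<in>C \<times> {..<m}. Q p) \<longleftrightarrow> (\<forall>c\<in>C. \<forall>r<m. Q (c, r))" for Q
    by auto
  have iff: "x \<in> ker (C \<times> {..<m}) (V \<times> {..<m}) (extX m b H) \<longleftrightarrow> pack m b x \<in> ker C V H"
    if x: "x \<in> vecs (V \<times> {..<m})" for x
  proof -
    \<comment> \<open>The \<open>m\<close> binary equations of block \<open>c\<close> say that all
      coordinates of one field element vanish, which is the single q-ary equation of
      \<open>c\<close>.\<close>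
    have "(\<forall>r<m. (\<Sum>i\<in>V \<times> {..<m}. extX m b H (c, r) i * x i) = 0)
        \<longleftrightarrow> (\<Sum>v\<in>V. H c v * pack m b x v) = 0" for c
    proof -
      have "(\<Sum>v\<in>V. H c v * pack m b x v)
          = bit_comb m b (\<lambda>r. \<Sum>i\<in>V \<times> {..<m}. extX m b H (c, r) i * x i)"
        using bit_comb_block_product[OF basis char2, where V=V and h="H c" and x=x]
        by (simp only: extX_def pack_def split_def prod.collapse fst_conv snd_conv)
      then show ?thesis
        using bit_comb_eq_iff[OF basis, of "\<lambda>r. \<Sum>i\<in>V \<times> {..<m}. extX m b H (c, r) i * x i" "\<lambda>_. 0"]
        by (simp only: bit_comb_zero)
    qed
    then have "(\<forall>p\<in>C \<times> {..<m}. (\<Sum>i\<in>V \<times> {..<m}. extX m b H p i * x i) = 0)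
        \<longleftrightarrow> (\<forall>c\<in>C. (\<Sum>v\<in>V. H c v * pack m b x v) = 0)"
      by (simp only: ball_prod)
    moreover have "pack m b x \<in> vecs V"
      using x bij_betwE[OF bij_betw_pack[OF basis, of V]] by blast
    ultimately show ?thesis using x unfolding ker_def by blast
  qed
  have "ker (C \<times> {..<m}) (V \<times> {..<m}) (extX m b H) \<subseteq> vecs (V \<times> {..<m})"
    by (auto simp: ker_def)
  moreover have "pack m b ` ker (C \<times> {..<m}) (V \<times> {..<m}) (extX m b H) = ker C V H"
  proof (intro set_eqI iffI)
    fix w assume "w \<in> pack m b ` ker (C \<times> {..<m}) (V \<times> {..<m}) (extX m b H)"
    then obtain x where "x \<in> ker (C \<times> {..<m}) (V \<times> {..<m}) (extX m b H)" "w = pack m b x" by blast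
    then show "w \<in> ker C V H" using iff[of x] by (simp add: ker_def)
  next
    fix w assume w: "w \<in> ker C V H"
    then have "w \<in> pack m b ` vecs (V \<times> {..<m})"
      using bij_betw_imp_surj_on[OF bij_betw_pack[OF basis, of V]] by (simp add: ker_def)
    then obtain x where x: "x \<in> vecs (V \<times> {..<m})" "w = pack m b x" by blast
    then show "w \<in> pack m b ` ker (C \<times> {..<m}) (V \<times> {..<m}) (extX m b H)"
      using iff[OF x(1)] w by blast
  qed
  ultimately have "bij_betw (pack m b) (ker (C \<times> {..<m}) (V \<times> {..<m}) (extX m b H)) (ker C V H)"
    by (rule bij_betw_subset[OF bij_betw_pack[OF basis, of V]])
  then show ?thesis by (rule bij_betw_same_card)
qed

lemma card_row_space_extZ:
  assumes basis: "is_F2_basis m b" and char2: "(1 + 1 :: 'a::field) = 0"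
  shows "card (row_space (C \<times> {..<m}) (V \<times> {..<m}) (extZ m b H))
    = card (row_space C V (H :: pt \<Rightarrow> pt \<Rightarrow> 'a))"
proof -
  let ?T = "row_comb (C \<times> {..<m}) (V \<times> {..<m}) (extZ m b H)"
  \<comment> \<open>A row combination multiplies by the transpose of the matrix, which undoes the
    transposes A(h)^T. Blocks A(h) thus act on the packed coefficients, and
    \<open>bit_comb_block_product\<close> applies with checks in place of variables.\<close>
  have comm: "pack m b (?T u) = row_comb C V H (pack m b u)" for u
  proof
    fix v
    show "pack m b (?T u) v = row_comb C V H (pack m b u) v"
    proof (cases "v \<in> V")
      case True
      have "pack m b (?T u) v
          = bit_comb m b (\<lambda>s. \<Sum>(c,r)\<in>C \<times> {..<m}. mulmat m b (H c v) s r * u (c,r))"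
        unfolding pack_def
        by (rule bit_comb_cong) (simp only: True row_comb_def extZ_def split_def mult.commute
            mem_Sigma_iff lessThan_iff simp_thms if_True prod.collapse fst_conv snd_conv)
      also have "\<dots> = (\<Sum>c\<in>C. H c v * pack m b u c)"
        unfolding pack_def by (rule bit_comb_block_product[OF basis char2])
      finally show ?thesis using True by (simp add: row_comb_def mult.commute)
    qed (simp add: row_comb_def pack_def)
  qed
  have "pack m b ` row_space (C \<times> {..<m}) (V \<times> {..<m}) (extZ m b H)
      = row_comb C V H ` pack m b ` vecs (C \<times> {..<m})"
    unfolding row_space_def image_image comm ..
  also have "\<dots> = row_space C V H"
    using bij_betw_imp_surj_on[OF bij_betw_pack[OF basis, of C]] by (simp add: row_space_def)
  finally have "pack m b ` row_space (C \<times> {..<m}) (V \<times> {..<m}) (extZ m b H) = row_space C V H" .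
  then have "bij_betw (pack m b) (row_space (C \<times> {..<m}) (V \<times> {..<m}) (extZ m b H)) (row_space C V H)"
    by (rule bij_betw_subset[OF bij_betw_pack[OF basis, of V] row_space_subset])
  then show ?thesis by (rule bij_betw_same_card)
qed

section \<open>The toric grid\<close>

text \<open>Integer coordinates turn neighbours into shifts by 1 or -1 and leave the wrap-around to
  the reduction; equality of nodes becomes divisibility by 2n.\<close>

definition node :: "nat \<Rightarrow> int \<Rightarrow> int \<Rightarrow> pt" where
  "node n i j = (nat (i mod (2 * int n)), nat (j mod (2 * int n)))"

text \<open>The parameter selects the parity class: X-checks for False, Z-checks for True.\<close>
definition checks :: "nat \<Rightarrow> bool \<Rightarrow> pt set" where
  "checks n s = {(i,j) \<in> grid n. even i = s \<and> odd j = s}"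

lemma CXnodes_eq_checks: "CXnodes n = checks n False"
  and CZnodes_eq_checks: "CZnodes n = checks n True"
  by (auto simp: CXnodes_def CZnodes_def checks_def)

lemma node_eq_iff:
  assumes "n > 0"
  shows "node n i j = node n k l \<longleftrightarrow> 2 * int n dvd i - k \<and> 2 * int n dvd j - l"
  using assms by (simp add: node_def eq_nat_nat_iff mod_eq_dvd_iff)

lemma node_of_nat: "i < 2 * n \<Longrightarrow> j < 2 * n \<Longrightarrow> node n (int i) (int j) = (i, j)"
  by (simp add: node_def)

lemma even_nat_mod:
  assumes "n > 0"
  shows "even (nat (i mod (2 * int n))) \<longleftrightarrow> even i"
  using assms by (simp add: even_nat_iff dvd_mod_iff)

lemma node_in_grid: "n > 0 \<Longrightarrow> node n i j \<in> grid n"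
  by (simp add: node_def grid_def nat_less_iff)

lemma node_in_checks_iff:
  "n > 0 \<Longrightarrow> node n i j \<in> checks n s \<longleftrightarrow> even i = s \<and> odd j = s"
  using node_in_grid[of n i j] by (auto simp: checks_def node_def even_nat_mod)

lemma node_in_Vnodes_iff:
  "n > 0 \<Longrightarrow> node n i j \<in> Vnodes n \<longleftrightarrow> even (i + j)"
  using node_in_grid[of n i j] by (auto simp: Vnodes_def node_def even_nat_mod)

lemma nbrs_node:
  assumes "n > 0"
  shows "nbrs n (node n i j) = {node n (i + 1) j, node n (i - 1) j, node n i (j + 1), node n i (j - 1)}"
proof -
  have 1: "(nat (k mod (2 * int n)) + 1) mod (2 * n) = nat ((k + 1) mod (2 * int n))" for k
  proof -
    have "int ((nat (k mod (2 * int n)) + 1) mod (2 * n)) = (k mod (2 * int n) + 1) mod (2 * int n)"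
      using assms by (simp add: zmod_int add.commute)
    then have "int ((nat (k mod (2 * int n)) + 1) mod (2 * n)) = (k + 1) mod (2 * int n)"
      by (simp only: mod_simps)
    then show ?thesis by (metis nat_int)
  qed
  have 2: "(nat (k mod (2 * int n)) + 2 * n - 1) mod (2 * n) = nat ((k - 1) mod (2 * int n))" for k
  proof -
    have "int ((nat (k mod (2 * int n)) + 2 * n - 1) mod (2 * n))
        = (k mod (2 * int n) + 2 * int n - 1) mod (2 * int n)"
      using assms by (simp add: zmod_int of_nat_diff)
    also have "\<dots> = ((k mod (2 * int n) - 1) + 2 * int n) mod (2 * int n)" by (simp add: algebra_simps)
    also have "\<dots> = (k - 1) mod (2 * int n)" by (simp only: mod_add_self2 mod_simps)
    finally show ?thesis by (metis nat_int)
  qed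
  show ?thesis using 1[of i] 1[of j] 2[of i] 2[of j] by (simp add: nbrs_def node_def)
qed

lemma adj_node_iff:
  assumes "n > 0"
  shows "adj n (node n i j) (node n k l) \<longleftrightarrow>
     (2 * int n dvd k - (i + 1) \<or> 2 * int n dvd k - (i - 1)) \<and> 2 * int n dvd l - j \<or>
     2 * int n dvd k - i \<and> (2 * int n dvd l - (j + 1) \<or> 2 * int n dvd l - (j - 1))"
  using assms by (auto simp: adj_def nbrs_node node_eq_iff)

lemma adj_node [simp]:
  assumes "n > 0"
  shows "adj n (node n i j) (node n (i + 1) j)" "adj n (node n i j) (node n (i - 1) j)"
    "adj n (node n i j) (node n i (j + 1))" "adj n (node n i j) (node n i (j - 1))"
  using assms by (auto simp: adj_def nbrs_node)

text \<open>Since 2n is at least 4, nodes at a small nonzero offset stay distinct on the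
  torus.\<close>

lemma not_dvd_small:
  assumes "n \<ge> 2" "k \<noteq> 0" "\<bar>k\<bar> < 4"
  shows "\<not> 2 * int n dvd k"
  using assms dvd_imp_le_int[of k "2 * int n"] by linarith

lemma checks_nodeE:
  assumes "c \<in> checks n s"
  obtains i j where "c = node n (int i) (int j)" "even i = s" "odd j = s" "i < 2 * n" "j < 2 * n"
  using assms that[of "fst c" "snd c"] by (auto simp: checks_def grid_def node_of_nat)

lemma finite_grid: "finite (grid n)"
  by (simp add: grid_def)

lemma finite_checks [simp]: "finite (checks n s)"
  by (rule finite_subset[OF _ finite_grid[of n]]) (auto simp: checks_def)

lemma finite_Vnodes [simp]: "finite (Vnodes n)"
  by (rule finite_subset[OF _ finite_grid[of n]]) (auto simp: Vnodes_def)

lemma card_checks: "card (checks n s) = n * n"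
proof -
  let ?f = "\<lambda>(p, r). (2 * p + (if s then 0 else 1), 2 * r + (if s then 1 else 0))"
  have "inj_on ?f ({..<n} \<times> {..<n})" by (auto simp: inj_on_def)
  moreover have "?f ` ({..<n} \<times> {..<n}) = checks n s"
  proof (intro set_eqI iffI)
    fix c assume "c \<in> checks n s"
    then show "c \<in> ?f ` ({..<n} \<times> {..<n})"
      by (intro image_eqI[of _ _ "(fst c div 2, snd c div 2)"])
        (auto simp: checks_def grid_def)
  qed (auto simp: checks_def grid_def split: if_splits)
  ultimately show ?thesis by (metis card_image card_cartesian_product card_lessThan)
qed

lemma card_Vnodes: "card (Vnodes n) = 2 * (n * n)"
proof -
  let ?f = "\<lambda>(p, r, s). (2 * p + of_bool s, 2 * r + of_bool s) :: pt"
  let ?A = "{..<n} \<times> {..<n} \<times> (UNIV :: bool set)"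
  have inj: "inj_on ?f ?A"
    by (auto simp: inj_on_def of_bool_def split: if_splits) presburger+
  have im: "?f ` ?A = Vnodes n"
  proof (intro set_eqI iffI)
    fix v assume "v \<in> Vnodes n"
    then show "v \<in> ?f ` ?A"
      by (intro image_eqI[of _ _ "(fst v div 2, snd v div 2, odd (fst v))"])
        (auto simp: Vnodes_def grid_def)
  qed (auto simp: Vnodes_def grid_def of_bool_def)
  have "card (Vnodes n) = card ?A" using card_image[OF inj] unfolding im .
  then show ?thesis by (simp add: card_cartesian_product)
qed

section \<open>Columns of a labeled matrix and its left kernel\<close>

lemma adjacent_checks_horizontal:
  assumes "n > 0" "node n i j \<in> checks n s" "c \<in> checks n s" "adj n c (node n (i + 1) j)"
  shows "c \<in> {node n i j, node n (i + 2) j}"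
proof -
  obtain k l where c: "c = node n k l" using checks_nodeE[OF assms(3)] by metis
  have par: "even k = s" "odd l = s" "even i = s" "odd j = s"
    using assms c by (auto simp: node_in_checks_iff)
  have ev: "even x" if "2 * int n dvd x" for x using that by (metis dvd_mult_left)
  from assms(4) consider
      "2 * int n dvd (i + 1) - (k + 1)" "2 * int n dvd j - l"
    | "2 * int n dvd (i + 1) - (k - 1)" "2 * int n dvd j - l"
    | "2 * int n dvd (i + 1) - k"
    unfolding c using assms(1) by (auto simp: adj_node_iff)
  then show ?thesis
  proof cases
    \<comment> \<open>The first coordinates of \<open>c\<close> and \<open>node n i j\<close> would
      differ in parity, although both are checks of class \<open>s\<close>.\<close>
    case 3
    from ev[OF this] par show ?thesis by auto
  qed (use assms(1) in \<open>auto simp: c node_eq_iff dvd_diff_commute algebra_simps\<close>)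
qed

lemma adjacent_checks_vertical:
  assumes "n > 0" "node n i j \<in> checks n s" "c \<in> checks n s" "adj n c (node n i (j + 1))"
  shows "c \<in> {node n i j, node n i (j + 2)}"
proof -
  obtain k l where c: "c = node n k l" using checks_nodeE[OF assms(3)] by metis
  have par: "even k = s" "odd l = s" "even i = s" "odd j = s"
    using assms c by (auto simp: node_in_checks_iff)
  have ev: "even x" if "2 * int n dvd x" for x using that by (metis dvd_mult_left)
  from assms(4) consider
      "2 * int n dvd (j + 1) - (l + 1)" "2 * int n dvd i - k"
    | "2 * int n dvd (j + 1) - (l - 1)" "2 * int n dvd i - k"
    | "2 * int n dvd (j + 1) - l"
    unfolding c using assms(1) by (auto simp: adj_node_iff)
  then show ?thesis
  proof cases
    case 3
    from ev[OF this] par show ?thesis by auto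
  qed (use assms(1) in \<open>auto simp: c node_eq_iff dvd_diff_commute algebra_simps\<close>)
qed

lemma Vnodes_cases:
  assumes "n > 0" "v \<in> Vnodes n"
  obtains i j where "node n i j \<in> checks n s" "v = node n (i + 1) j"
  | i j where "node n i j \<in> checks n s" "v = node n i (j + 1)"
proof -
  define k l where "k = fst v" and "l = snd v"
  then have kl: "v = node n (int k) (int l)" "even (k + l)"
    using assms by (auto simp: Vnodes_def grid_def node_of_nat)
  show ?thesis
  proof (cases "even k = s")
    case True
    then show ?thesis
      using that(2)[of "int k" "int l - 1"] kl assms(1) by (auto simp: node_in_checks_iff)
  next
    case False
    then show ?thesis
      using that(1)[of "int k - 1" "int l"] kl assms(1) by (auto simp: node_in_checks_iff)
  qed
qed

lemma horizontal_column_sum: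
  fixes H :: "pt \<Rightarrow> pt \<Rightarrow> 'a::field"
  assumes n: "n \<ge> 2" and H: "is_labeling n (checks n s) H" and c: "node n i j \<in> checks n s"
  shows "(\<Sum>c\<in>checks n s. u c * H c (node n (i + 1) j))
    = u (node n i j) * H (node n i j) (node n (i + 1) j)
    + u (node n (i + 2) j) * H (node n (i + 2) j) (node n (i + 1) j)"
proof -
  have n0: "n > 0" using n by simp
  have par: "even i = s" "odd j = s" using c n0 by (auto simp: node_in_checks_iff)
  \<comment> \<open>The two ends of a grid edge are distinct because 2 is nonzero mod 2n.\<close>
  have ne: "node n i j \<noteq> node n (i + 2) j"
    using not_dvd_small[OF n, of "-2"] n0 by (simp add: node_eq_iff)
  have "(\<Sum>c\<in>checks n s. u c * H c (node n (i + 1) j))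
      = (\<Sum>c\<in>{node n i j, node n (i + 2) j}. u c * H c (node n (i + 1) j))"
  proof (rule sum.mono_neutral_right)
    show "\<forall>d\<in>checks n s - {node n i j, node n (i + 2) j}. u d * H d (node n (i + 1) j) = 0"
    proof
      fix d assume d: "d \<in> checks n s - {node n i j, node n (i + 2) j}"
      moreover have "node n (i + 1) j \<in> Vnodes n" using par n0 by (auto simp: node_in_Vnodes_iff)
      ultimately have "H d (node n (i + 1) j) = 0"
        using adjacent_checks_horizontal[OF n0 c, of d] H unfolding is_labeling_def by blast
      then show "u d * H d (node n (i + 1) j) = 0" by simp
    qed
  qed (use par n0 in \<open>auto simp: node_in_checks_iff\<close>)
  then show ?thesis using ne by simp
qed

lemma vertical_column_sum:
  fixes H :: "pt \<Rightarrow> pt \<Rightarrow> 'a::field"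
  assumes n: "n \<ge> 2" and H: "is_labeling n (checks n s) H" and c: "node n i j \<in> checks n s"
  shows "(\<Sum>c\<in>checks n s. u c * H c (node n i (j + 1)))
    = u (node n i j) * H (node n i j) (node n i (j + 1))
    + u (node n i (j + 2)) * H (node n i (j + 2)) (node n i (j + 1))"
proof -
  have n0: "n > 0" using n by simp
  have par: "even i = s" "odd j = s" using c n0 by (auto simp: node_in_checks_iff)
  have ne: "node n i j \<noteq> node n i (j + 2)"
    using not_dvd_small[OF n, of "-2"] n0 by (simp add: node_eq_iff)
  have "(\<Sum>c\<in>checks n s. u c * H c (node n i (j + 1)))
      = (\<Sum>c\<in>{node n i j, node n i (j + 2)}. u c * H c (node n i (j + 1)))"
  proof (rule sum.mono_neutral_right)
    show "\<forall>d\<in>checks n s - {node n i j, node n i (j + 2)}. u d * H d (node n i (j + 1)) = 0"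
    proof
      fix d assume d: "d \<in> checks n s - {node n i j, node n i (j + 2)}"
      moreover have "node n i (j + 1) \<in> Vnodes n" using par n0 by (auto simp: node_in_Vnodes_iff)
      ultimately have "H d (node n i (j + 1)) = 0"
        using adjacent_checks_vertical[OF n0 c, of d] H unfolding is_labeling_def by blast
      then show "u d * H d (node n i (j + 1)) = 0" by simp
    qed
  qed (use par n0 in \<open>auto simp: node_in_checks_iff\<close>)
  then show ?thesis using ne by simp
qed

text \<open>H = diag(g) B diag(f) with B the 0/1 incidence matrix of a connected graph; over
  characteristic 2 the left kernel of B consists of the constant vectors.\<close>
lemma card_left_kernel_of_factorization:
  fixes H :: "pt \<Rightarrow> pt \<Rightarrow> 'a::{field,finite}"
  assumes char2: "(1 + 1 :: 'a) = 0" and n: "n \<ge> 2" and H: "is_labeling n (checks n s) H"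
    and fac: "\<And>c v. c \<in> checks n s \<Longrightarrow> v \<in> Vnodes n \<Longrightarrow> adj n c v \<Longrightarrow> H c v = g c * f v"
    and g: "\<And>c. c \<in> checks n s \<Longrightarrow> g c \<noteq> 0"
  shows "card {u \<in> vecs (checks n s). row_comb (checks n s) (Vnodes n) H u = 0} = card (UNIV :: 'a set)"
proof -
  let ?C = "checks n s" and ?V = "Vnodes n"
  let ?K = "{u \<in> vecs ?C. row_comb ?C ?V H u = 0}"
  have n0: "n > 0" using n by simp
  note add_eq_0 = char_two_add_eq_zero_iff[OF char2]
  have nz: "f v \<noteq> 0" if "c \<in> ?C" "v \<in> ?V" "adj n c v" for c v
    using fac[OF that] H that unfolding is_labeling_def by (metis mult_zero_right)
  \<comment> \<open>After dividing by f at the variable, characteristic 2 turns the vanishing of the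
    two-term sum into equality of u g at the two ends.\<close>
  have h: "(\<Sum>c\<in>?C. u c * H c (node n (i + 1) j)) = 0
      \<longleftrightarrow> u (node n i j) * g (node n i j) = u (node n (i + 2) j) * g (node n (i + 2) j)"
    if c: "node n i j \<in> ?C" for u i j
  proof -
    let ?v = "node n (i + 1) j"
    have m: "node n (i + 2) j \<in> ?C" "?v \<in> ?V" "adj n (node n i j) ?v"
      using c n0 by (auto simp: node_in_checks_iff node_in_Vnodes_iff)
    have a: "adj n (node n (i + 2) j) ?v" using adj_node(2)[OF n0, of "i + 2" j] by (simp add: algebra_simps)
    have "(\<Sum>c\<in>?C. u c * H c ?v) = (u (node n i j) * g (node n i j) + u (node n (i + 2) j) * g (node n (i + 2) j)) * f ?v"
      using horizontal_column_sum[OF n H c, of u] fac[OF c m(2,3)] fac[OF m(1,2) a] by (simp add: algebra_simps)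
    then show ?thesis using nz[OF c m(2,3)] by (simp add: add_eq_0)
  qed
  have w: "(\<Sum>c\<in>?C. u c * H c (node n i (j + 1))) = 0
      \<longleftrightarrow> u (node n i j) * g (node n i j) = u (node n i (j + 2)) * g (node n i (j + 2))"
    if c: "node n i j \<in> ?C" for u i j
  proof -
    let ?v = "node n i (j + 1)"
    have m: "node n i (j + 2) \<in> ?C" "?v \<in> ?V" "adj n (node n i j) ?v"
      using c n0 by (auto simp: node_in_checks_iff node_in_Vnodes_iff)
    have a: "adj n (node n i (j + 2)) ?v" using adj_node(4)[OF n0, of i "j + 2"] by (simp add: algebra_simps)
    have "(\<Sum>c\<in>?C. u c * H c ?v) = (u (node n i j) * g (node n i j) + u (node n i (j + 2)) * g (node n i (j + 2))) * f ?v"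
      using vertical_column_sum[OF n H c, of u] fac[OF c m(2,3)] fac[OF m(1,2) a] by (simp add: algebra_simps)
    then show ?thesis using nz[OF c m(2,3)] by (simp add: add_eq_0)
  qed
  \<comment> \<open>The base check is (1,0) for X-checks and (0,1) for Z-checks; every check of the
    class is reached from it by steps of length 2.\<close>
  define i0 :: int where "i0 = of_bool (\<not> s)"
  define j0 :: int where "j0 = of_bool s"
  let ?c0 = "node n i0 j0"
  \<comment> \<open>\<open>?F k\<close> is the vector for which u g has the constant value
    \<open>k\<close> on the checks.\<close>
  let ?F = "\<lambda>k c. if c \<in> ?C then k / g c else 0"
  have base: "node n (i0 + 2 * int p) (j0 + 2 * int r) \<in> ?C" for p r
    using n0 by (simp add: node_in_checks_iff i0_def j0_def)
  have c0: "?c0 \<in> ?C" using base[of 0 0] by simp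
  have inj: "inj ?F"
  proof (rule injI)
    fix k l assume "?F k = ?F l"
    from fun_cong[OF this, of ?c0] show "k = l" using c0 g[OF c0] by simp
  qed
  have range: "range ?F = ?K"
  proof (intro set_eqI iffI)
    fix u assume "u \<in> range ?F"
    then obtain k where u: "u = ?F k" by blast
    have ug: "u c * g c = k" if "c \<in> ?C" for c using that g[OF that] by (simp add: u)
    have "row_comb ?C ?V H u v = 0" for v
    proof (cases "v \<in> ?V")
      case True
      from n0 True show ?thesis
      proof (cases rule: Vnodes_cases[where s = s])
        case (1 i j)
        then have "node n (i + 2) j \<in> ?C" using n0 by (simp add: node_in_checks_iff)
        then show ?thesis using h[OF 1(1), of u] ug 1 True by (simp add: row_comb_def)
      next
        case (2 i j)
        then have "node n i (j + 2) \<in> ?C" using n0 by (simp add: node_in_checks_iff)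
        then show ?thesis using w[OF 2(1), of u] ug 2 True by (simp add: row_comb_def)
      qed
    qed (simp add: row_comb_def)
    then show "u \<in> ?K" by (auto simp: u vecs_def)
  next
    fix u assume u: "u \<in> ?K"
    have z: "(\<Sum>c\<in>?C. u c * H c v) = 0" if "v \<in> ?V" for v
    proof -
      have "row_comb ?C ?V H u v = 0" using u by simp
      then show ?thesis using that by (simp add: row_comb_def)
    qed
    have row: "u (node n (i0 + 2 * int p) j0) * g (node n (i0 + 2 * int p) j0) = u ?c0 * g ?c0" for p
    proof (induction p)
      case (Suc p)
      have c: "node n (i0 + 2 * int p) j0 \<in> ?C" using base[of p 0] by simp
      then have "node n (i0 + 2 * int p + 1) j0 \<in> ?V" using n0 by (auto simp: node_in_checks_iff node_in_Vnodes_iff)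
      then show ?case using h[OF c, of u] z Suc by (simp add: algebra_simps)
    qed simp
    have all: "u (node n (i0 + 2 * int p) (j0 + 2 * int r)) * g (node n (i0 + 2 * int p) (j0 + 2 * int r)) = u ?c0 * g ?c0" for p r
    proof (induction r)
      case (Suc r)
      have "node n (i0 + 2 * int p) (j0 + 2 * int r + 1) \<in> ?V"
        using n0 base[of p r] by (auto simp: node_in_checks_iff node_in_Vnodes_iff)
      then show ?case using w[OF base[of p r], of u] z Suc by (simp add: algebra_simps)
    qed (simp add: row)
    have "u = ?F (u ?c0 * g ?c0)"
    proof
      fix c
      show "u c = ?F (u ?c0 * g ?c0) c"
      proof (cases "c \<in> ?C")
        case True
        then obtain i j where ij: "c = node n (int i) (int j)" "even i = s" "odd j = s"
          by (rule checks_nodeE)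
        then have "i = of_bool (\<not> s) + 2 * (i div 2)" "j = of_bool s + 2 * (j div 2)"
          by (cases s; simp)+
        then have "int i = i0 + 2 * int (i div 2)" "int j = j0 + 2 * int (j div 2)"
          unfolding i0_def j0_def by (metis of_nat_add of_nat_mult of_nat_numeral of_nat_of_bool)+
        then have "u c * g c = u ?c0 * g ?c0" using all[of "i div 2" "j div 2"] ij(1) by simp
        then show ?thesis using True g[OF True] by (simp add: field_simps)
      qed (use u in \<open>cases c; simp add: vecs_def\<close>)
    qed
    then show "u \<in> range ?F" by (rule range_eqI)
  qed
  show ?thesis using card_image[OF inj] unfolding range .
qed

section \<open>Factorization of the labelings\<close>

lemma periodic_mod:
  fixes f :: "nat \<Rightarrow> 'a"
  assumes "\<And>p. f (p + n) = f p"
  shows "f (p mod n) = f p"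
proof -
  have "f (q + k * n) = f q" for q k
  proof (induction k)
    case (Suc k)
    then show ?case using assms[of "q + k * n"] by (simp add: algebra_simps)
  qed simp
  from this[of "p mod n" "p div n"] show ?thesis by simp
qed

text \<open>A multiplicative potential with prescribed step ratios: \<open>face\<close> gives path
  independence locally, while \<open>row\<close> and \<open>col\<close> make the two generating
  loops of the torus trivial.\<close>

lemma torus_potential_exists:
  fixes \<alpha> \<beta> :: "nat \<Rightarrow> nat \<Rightarrow> 'a::field"
  assumes nz: "\<And>p r. \<alpha> p r \<noteq> 0" "\<And>p r. \<beta> p r \<noteq> 0"
    and per: "\<And>p. \<alpha> (p + n) 0 = \<alpha> p 0" "\<And>p r. \<beta> (p + n) r = \<beta> p r" "\<And>p r. \<beta> p (r + n) = \<beta> p r"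
    and face: "\<And>p r. \<alpha> p r * \<beta> (Suc p) r = \<beta> p r * \<alpha> p (Suc r)"
    and row: "(\<Prod>p<n. \<alpha> p 0) = 1" and col: "\<And>p. (\<Prod>r<n. \<beta> p r) = 1"
  obtains a where "\<And>p r. a p r \<noteq> 0"
    "\<And>p r. a (Suc p) r = a p r * \<alpha> p r" "\<And>p r. a p (Suc r) = a p r * \<beta> p r"
    "\<And>p r. a (p + n) r = a p r" "\<And>p r. a p (r + n) = a p r"
proof -
  \<comment> \<open>The ratios are multiplied along row 0 up to \<open>p\<close> and then along
    column \<open>p\<close> up to \<open>r\<close>. The other steps follow by crossing faces one at
    a time.\<close>
  define a where "a = (\<lambda>p r. (\<Prod>k<p. \<alpha> k 0) * (\<Prod>l<r. \<beta> p l))"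
  have 0: "a p r \<noteq> 0" for p r by (simp add: a_def nz)
  have 2: "a p (Suc r) = a p r * \<beta> p r" for p r by (simp add: a_def)
  have 1: "a (Suc p) r = a p r * \<alpha> p r" for p r
  proof (induction r)
    case (Suc r)
    then show ?case using face[of p r] by (simp add: 2)
  qed (simp add: a_def)
  have "a (p + n) 0 = a p 0" for p
  proof (induction p)
    case (Suc p)
    then show ?case by (simp add: 1 per)
  qed (simp add: a_def row)
  then have 3: "a (p + n) r = a p r" for p r
    by (induction r) (simp_all add: 2 per)
  have 4: "a p (r + n) = a p r" for p r
    by (induction r) (simp_all add: 2 per, simp add: a_def col)
  show ?thesis using that[of a] 0 1 2 3 4 by blast
qed

text \<open>A cycle product pairs the two entries of each check. Shifting the denominators
  cyclically pairs the two entries of each variable instead, the ratios of which the potential is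
  built.\<close>

lemma closed_line_product:
  fixes H :: "pt \<Rightarrow> pt \<Rightarrow> 'a::field"
  assumes cyc: "\<And>vs cs. is_cycle n C vs cs \<Longrightarrow> cycle_prod H vs cs = 1"
    and k: "k > 0" and per: "c k = c 0" "v k = v 0"
    and inj: "inj_on c {..<k}" "inj_on v {..<k}"
    and mem: "\<And>t. t < k \<Longrightarrow> c t \<in> C" "\<And>t. t < k \<Longrightarrow> v t \<in> Vnodes n"
    and adj: "\<And>t. t < k \<Longrightarrow> adj n (c t) (v t)" "\<And>t. t < k \<Longrightarrow> adj n (c t) (v (Suc t))"
  shows "(\<Prod>t<k. H (c t) (v (Suc t)) / H (c (Suc t)) (v (Suc t))) = 1"
proof -
  let ?vs = "map v [0..<k]" and ?cs = "map c [0..<k]"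
  have nxt: "?vs ! (Suc t mod k) = v (Suc t)" if "t < k" for t
    using that per k by (cases "Suc t = k") auto
  have "is_cycle n C ?vs ?cs"
    unfolding is_cycle_def using k inj mem adj nxt
    by (auto simp: distinct_map lessThan_atLeast0)
  from cyc[OF this] have "(\<Prod>t<k. H (c t) (v (Suc t)) * inverse (H (c t) (v t))) = 1"
    unfolding cycle_prod_def using nxt by simp
  moreover have "(\<Prod>t<k. H (c (Suc t)) (v (Suc t))) = (\<Prod>t<k. H (c t) (v t))"
  proof -
    obtain l where l: "k = Suc l" using k by (cases k) auto
    have "(\<Prod>t<Suc l. H (c t) (v t)) = H (c 0) (v 0) * (\<Prod>t<l. H (c (Suc t)) (v (Suc t)))"
      by (rule prod.lessThan_Suc_shift)
    then show ?thesis using per by (simp add: l)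
  qed
  ultimately show ?thesis
    by (simp add: prod_dividef prod.distrib flip: divide_inverse prod_inversef)
qed

lemma labeling_factorization:
  fixes H :: "pt \<Rightarrow> pt \<Rightarrow> 'a::field"
  assumes n: "n \<ge> 2" and H: "is_labeling n (checks n False) H"
    and cyc: "\<And>vs cs. is_cycle n (checks n False) vs cs \<Longrightarrow> cycle_prod H vs cs = 1"
  obtains g f where "\<And>c. c \<in> checks n False \<Longrightarrow> g c \<noteq> 0"
    "\<And>c v. c \<in> checks n False \<Longrightarrow> v \<in> Vnodes n \<Longrightarrow> adj n c v \<Longrightarrow> H c v = g c * f v"
proof -
  have n0: "n > 0" using n by simp
  let ?C = "checks n False"
  \<comment> \<open>\<open>x p r\<close> are the X-checks, \<open>h p r\<close> is the variable
    between \<open>x p r\<close> and \<open>x (Suc p) r\<close>, and \<open>w p r\<close> the one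
    between \<open>x p r\<close> and \<open>x p (Suc r)\<close>.\<close>
  define x where "x = (\<lambda>p r. node n (2 * int p + 1) (2 * int r))"
  define h where "h = (\<lambda>p r. node n (2 * int p + 2) (2 * int r))"
  define w where "w = (\<lambda>p r. node n (2 * int p + 1) (2 * int r + 1))"
  have mem: "x p r \<in> ?C" "h p r \<in> Vnodes n" "w p r \<in> Vnodes n" for p r
    using n0 by (simp_all add: x_def h_def w_def node_in_checks_iff node_in_Vnodes_iff)
  have adj: "adj n (x p r) (h p r)" "adj n (x (Suc p) r) (h p r)"
      "adj n (x p r) (w p r)" "adj n (x p (Suc r)) (w p r)" for p r
    using n0 by (simp_all add: x_def h_def w_def adj_node_iff)
  have nz: "H (x p r) (h p r) \<noteq> 0" "H (x (Suc p) r) (h p r) \<noteq> 0"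
      "H (x p r) (w p r) \<noteq> 0" "H (x p (Suc r)) (w p r) \<noteq> 0" for p r
    using H mem adj unfolding is_labeling_def by blast+
  have per: "x (p + n) r = x p r" "x p (r + n) = x p r" "h (p + n) r = h p r" "h p (r + n) = h p r"
      "w (p + n) r = w p r" "w p (r + n) = w p r" for p r
    using n0 by (simp_all add: x_def h_def w_def node_eq_iff algebra_simps)
  \<comment> \<open>With these ratios a potential \<open>a\<close> makes a(c) H(c,v) agree at the
    two checks next to each variable.\<close>
  define \<alpha> where "\<alpha> = (\<lambda>p r. H (x p r) (h p r) / H (x (Suc p) r) (h p r))"
  define \<beta> where "\<beta> = (\<lambda>p r. H (x p r) (w p r) / H (x p (Suc r)) (w p r))"
  have small: "2 * int n dvd 2 * int p - 2 * int q \<Longrightarrow> p = q" if "p < n" "q < n" for p q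
  proof -
    assume "2 * int n dvd 2 * int p - 2 * int q"
    then show "p = q" using that dvd_imp_le_int[of "2 * int p - 2 * int q" "2 * int n"] by linarith
  qed
  have row: "(\<Prod>p<n. \<alpha> p 0) = 1"
  proof -
    \<comment> \<open>Variable \<open>t\<close> precedes check \<open>t\<close>, whereas
      \<open>h t 0\<close> follows it; hence the index shift by one.\<close>
    let ?v = "\<lambda>t. node n (2 * int t) 0"
    have "(\<Prod>t<n. H (x t 0) (?v (Suc t)) / H (x (Suc t) 0) (?v (Suc t))) = 1"
    proof (rule closed_line_product[OF cyc n0])
      show "inj_on (\<lambda>t. x t 0) {..<n}" "inj_on ?v {..<n}"
        using n0 small by (auto simp: inj_on_def x_def node_eq_iff)
      show "x n 0 = x 0 0" using per(1)[of 0 0] by simp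
      show "?v n = ?v 0" by (simp add: node_eq_iff[OF n0])
      show "x t 0 \<in> ?C" for t by (rule mem(1))
      show "?v t \<in> Vnodes n" "adj n (x t 0) (?v t)" "adj n (x t 0) (?v (Suc t))" for t
        by (simp_all add: x_def adj_node_iff[OF n0] node_in_Vnodes_iff[OF n0])
    qed
    moreover have "?v (Suc t) = h t 0" for t by (simp add: h_def algebra_simps)
    ultimately show ?thesis by (simp add: \<alpha>_def)
  qed
  have col: "(\<Prod>r<n. \<beta> p r) = 1" for p
  proof -
    let ?v = "\<lambda>t. node n (2 * int p + 1) (2 * int t - 1)"
    have "(\<Prod>t<n. H (x p t) (?v (Suc t)) / H (x p (Suc t)) (?v (Suc t))) = 1"
    proof (rule closed_line_product[OF cyc n0])
      show "inj_on (x p) {..<n}" "inj_on ?v {..<n}"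
        using n0 small by (auto simp: inj_on_def x_def node_eq_iff)
      show "x p n = x p 0" using per(2)[of p 0] by simp
      show "?v n = ?v 0" by (simp add: node_eq_iff[OF n0])
      show "x p t \<in> ?C" for t by (rule mem(1))
      show "?v t \<in> Vnodes n" "adj n (x p t) (?v t)" "adj n (x p t) (?v (Suc t))" for t
        by (simp_all add: x_def adj_node_iff[OF n0] node_in_Vnodes_iff[OF n0])
    qed
    moreover have "?v (Suc t) = w p t" for t by (simp add: w_def algebra_simps)
    ultimately show ?thesis by (simp add: \<beta>_def)
  qed
  have face: "\<alpha> p r * \<beta> (Suc p) r = \<beta> p r * \<alpha> p (Suc r)" for p r
  proof -
    \<comment> \<open>These four variables surround the Z-check at (2p+2, 2r+1), and the four
      X-checks are its diagonal neighbours.\<close>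
    let ?vs = "[w p r, h p r, w (Suc p) r, h p (Suc r)]"
    let ?cs = "[x p r, x (Suc p) r, x (Suc p) (Suc r), x p (Suc r)]"
    have "is_cycle n ?C ?vs ?cs"
    proof -
      have "distinct ?vs" "distinct ?cs"
        using n0 by (simp_all add: x_def h_def w_def node_eq_iff not_dvd_small[OF n])
      moreover have "t = 0 \<or> t = 1 \<or> t = 2 \<or> t = 3" if "t < length ?vs" for t
        using that by auto
      ultimately show ?thesis
        unfolding is_cycle_def using mem adj by fastforce
    qed
    from cyc[OF this] show ?thesis
      using nz by (simp add: cycle_prod_def \<alpha>_def \<beta>_def lessThan_Suc field_simps)
  qed
  obtain a where a: "\<And>p r. a p r \<noteq> 0"
    "\<And>p r. a (Suc p) r = a p r * \<alpha> p r" "\<And>p r. a p (Suc r) = a p r * \<beta> p r"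
    "\<And>p r. a (p + n) r = a p r" "\<And>p r. a p (r + n) = a p r"
  proof (rule torus_potential_exists[of \<alpha> \<beta> n])
    show "\<alpha> p r \<noteq> 0" "\<beta> p r \<noteq> 0" for p r by (simp_all add: \<alpha>_def \<beta>_def nz)
    show "\<alpha> (p + n) 0 = \<alpha> p 0" for p using per(1)[of "Suc p" 0] by (simp add: \<alpha>_def per)
    show "\<beta> (p + n) r = \<beta> p r" for p r by (simp add: \<beta>_def per)
    show "\<beta> p (r + n) = \<beta> p r" for p r using per(2)[of p "Suc r"] by (simp add: \<beta>_def per)
  qed (use row col face in auto)
  \<comment> \<open>Halving recovers (p,r) mod n from the coordinates (2p+1, 2r); periodicity of
    \<open>a\<close> makes the value independent of representatives.\<close>
  define A where "A = (\<lambda>c::pt. a (fst c div 2) (snd c div 2))"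
  have A: "A (x p r) = a p r" for p r
  proof -
    have "x p r = (2 * (p mod n) + 1, 2 * (r mod n))"
    proof -
      have "x p r = x (p mod n) (r mod n)"
        using periodic_mod[of "\<lambda>p. x p r" n p] periodic_mod[of "x (p mod n)" n r] per by simp
      also have "\<dots> = node n (int (2 * (p mod n) + 1)) (int (2 * (r mod n)))"
        by (simp add: x_def add.commute)
      also have "\<dots> = (2 * (p mod n) + 1, 2 * (r mod n))"
      proof (rule node_of_nat)
        have "p mod n < n" "r mod n < n" using n0 by auto
        then show "2 * (p mod n) + 1 < 2 * n" "2 * (r mod n) < 2 * n" by linarith+
      qed
      finally show ?thesis .
    qed
    then have "A (x p r) = a (p mod n) (r mod n)" by (simp add: A_def)
    then show ?thesis
      using periodic_mod[of "\<lambda>p. a p r" n p] periodic_mod[of "a (p mod n)" n r] a(4,5) by simp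
  qed
  have stepA: "A (x (Suc p) r) * H (x (Suc p) r) (h p r) = A (x p r) * H (x p r) (h p r)"
      "A (x p (Suc r)) * H (x p (Suc r)) (w p r) = A (x p r) * H (x p r) (w p r)" for p r
    using nz by (simp_all add: A a(2,3) \<alpha>_def \<beta>_def)
  have same: "A c * H c v = A d * H d v"
    if cd: "c \<in> ?C" "d \<in> ?C" and v: "v \<in> Vnodes n" and ad: "adj n c v" "adj n d v" for c d v
  proof -
    obtain k l where v': "v = (k, l)" "k < 2 * n" "l < 2 * n" "even k = even l"
      using v by (auto simp: Vnodes_def grid_def)
    then have vn: "v = node n (int k) (int l)" by (simp add: node_of_nat)
    show ?thesis
    proof (cases "even k")
      case True
      \<comment> \<open>The first coordinate of \<open>h p r\<close> is 2p+2, which calls for k/2 -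
        1; adding \<open>n\<close> prevents underflow at \<open>k = 0\<close> and vanishes mod
        2n.\<close>
      define p r where "p = k div 2 + n - 1" and "r = l div 2"
      have "int k = 2 * int (k div 2)" "int l = 2 * int r"
        using True v'(4) by (auto simp: r_def elim!: evenE)
      then have "int k - (2 * int p + 2) = - (2 * int n)" "int l - 2 * int r = 0"
        using n0 by (simp_all add: p_def of_nat_diff)
      then have hv: "v = h p r"
        unfolding vn h_def node_eq_iff[OF n0] by (simp only: dvd_minus_iff dvd_refl dvd_0_right)
      have "h p r = node n (2 * int p + 1 + 1) (2 * int r)"
        and "x (Suc p) r = node n (2 * int p + 1 + 2) (2 * int r)"
        by (simp_all add: h_def x_def algebra_simps)
      then have "e \<in> {x p r, x (Suc p) r}" if "e \<in> ?C" "adj n e v" for e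
        using adjacent_checks_horizontal[OF n0 mem(1)[of p r, unfolded x_def] that(1)] that(2)
        unfolding hv by (simp only: x_def)
      from this[OF cd(1) ad(1)] this[OF cd(2) ad(2)] show ?thesis
        using stepA(1)[of p r] hv by auto
    next
      case False
      define p r where "p = k div 2" and "r = l div 2"
      have "int k = 2 * int p + 1" "int l = 2 * int r + 1"
        using False v'(4) by (auto simp: p_def r_def elim!: oddE)
      then have hv: "v = w p r" unfolding vn w_def by simp
      have "w p r = node n (2 * int p + 1) (2 * int r + 1)"
        and "x p (Suc r) = node n (2 * int p + 1) (2 * int r + 2)"
        by (simp_all add: w_def x_def algebra_simps)
      then have "e \<in> {x p r, x p (Suc r)}" if "e \<in> ?C" "adj n e v" for e
        using adjacent_checks_vertical[OF n0 mem(1)[of p r, unfolded x_def] that(1)] that(2)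
        unfolding hv by (simp only: x_def)
      from this[OF cd(1) ad(1)] this[OF cd(2) ad(2)] show ?thesis
        using stepA(2)[of p r] hv by auto
    qed
  qed
  have An: "A c \<noteq> 0" for c by (simp add: A_def a)
  \<comment> \<open>By \<open>same\<close> the value does not depend on the chosen adjacent
    check.\<close>
  define f where "f = (\<lambda>v. let c = (SOME c. c \<in> ?C \<and> adj n c v) in A c * H c v)"
  have "H c v = inverse (A c) * f v" if "c \<in> ?C" "v \<in> Vnodes n" "adj n c v" for c v
  proof -
    define d where "d = (SOME c. c \<in> ?C \<and> adj n c v)"
    have "d \<in> ?C \<and> adj n d v" unfolding d_def by (rule someI[of _ c]) (use that in simp)
    then have "A c * H c v = f v" using same[of c d v] that unfolding f_def d_def[symmetric] by simp
    then show ?thesis using An[of c] by (simp add: field_simps)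
  qed
  then show ?thesis using that[of "\<lambda>c. inverse (A c)" f] An by simp
qed

lemma dual_labeling_factorization:
  fixes HX HZ :: "pt \<Rightarrow> pt \<Rightarrow> 'a::field"
  assumes char2: "(1 + 1 :: 'a) = 0" and n: "n \<ge> 2"
    and HX: "is_labeling n (checks n False) HX" and HZ: "is_labeling n (checks n True) HZ"
    and fac: "\<And>c v. c \<in> checks n False \<Longrightarrow> v \<in> Vnodes n \<Longrightarrow> adj n c v \<Longrightarrow> HX c v = g c * f v"
    and orth: "\<And>c d. c \<in> checks n False \<Longrightarrow> d \<in> checks n True \<Longrightarrow> (\<Sum>v\<in>Vnodes n. HX c v * HZ d v) = 0"
  obtains g' where "\<And>d. d \<in> checks n True \<Longrightarrow> g' d \<noteq> 0"
    "\<And>d v. d \<in> checks n True \<Longrightarrow> v \<in> Vnodes n \<Longrightarrow> adj n d v \<Longrightarrow> HZ d v = g' d * inverse (f v)"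
proof -
  have n0: "n > 0" using n by simp
  let ?V = "Vnodes n"
  note add_eq_0 = char_two_add_eq_zero_iff[OF char2]
  \<comment> \<open>The signs \<open>s\<close> and \<open>t\<close> select a diagonal X-check (k+s,
    l+t), which shares with the Z-check (k,l) exactly the variables (k+s, l) and (k, l+t).\<close>
  have cross: "HZ (node n k l) (node n (k + s) l) * f (node n (k + s) l)
      = HZ (node n k l) (node n k (l + t)) * f (node n k (l + t))"
    if kl: "even k" "odd l" and st: "s = 1 \<or> s = -1" "t = 1 \<or> t = -1" for k l s t
  proof -
    let ?d = "node n k l" and ?c = "node n (k + s) (l + t)"
    let ?v = "node n (k + s) l" and ?w = "node n k (l + t)"
    have mem: "?d \<in> checks n True" "?c \<in> checks n False" "?v \<in> ?V" "?w \<in> ?V"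
      using kl st n0 by (auto simp: node_in_checks_iff node_in_Vnodes_iff)
    have ad: "adj n ?c ?v" "adj n ?c ?w"
      using st n0 by (auto simp: adj_node_iff)
    have ne: "?v \<noteq> ?w" using st not_dvd_small[OF n, of s] by (auto simp: node_eq_iff[OF n0])
    have only: "v \<in> {?v, ?w}" if "adj n ?c v" "adj n ?d v" for v
    proof -
      have "v \<in> {?v, ?w, node n (k - s) l, node n k (l - t)}"
        using that(2) st by (auto simp: adj_def nbrs_node[OF n0])
      moreover have "\<not> adj n ?c (node n (k - s) l)" "\<not> adj n ?c (node n k (l - t))"
        using st not_dvd_small[OF n, of t] not_dvd_small[OF n, of s]
          not_dvd_small[OF n, of "- 2 * t"] not_dvd_small[OF n, of "- 2 * s"]
        by (auto simp: adj_node_iff[OF n0])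
      ultimately show ?thesis using that(1) by auto
    qed
    have "(\<Sum>v\<in>?V. HX ?c v * HZ ?d v) = (\<Sum>v\<in>{?v, ?w}. HX ?c v * HZ ?d v)"
    proof (rule sum.mono_neutral_right)
      show "\<forall>v\<in>?V - {?v, ?w}. HX ?c v * HZ ?d v = 0"
      proof
        fix v assume v: "v \<in> ?V - {?v, ?w}"
        then have "HX ?c v = 0 \<or> HZ ?d v = 0"
          using only[of v] HX HZ mem(1,2) unfolding is_labeling_def by blast
        then show "HX ?c v * HZ ?d v = 0" by auto
      qed
    qed (use mem in auto)
    then have "HX ?c ?v * HZ ?d ?v + HX ?c ?w * HZ ?d ?w = 0"
      using orth[OF mem(2,1)] ne by simp
    then have "HX ?c ?v * HZ ?d ?v = HX ?c ?w * HZ ?d ?w" by (simp add: add_eq_0)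
    then have "g ?c * (HZ ?d ?v * f ?v) = g ?c * (HZ ?d ?w * f ?w)"
      using fac[OF mem(2,3) ad(1)] fac[OF mem(2,4) ad(2)] by (simp add: mult_ac)
    moreover have "HX ?c ?v \<noteq> 0" using HX mem ad unfolding is_labeling_def by blast
    then have "g ?c \<noteq> 0" using fac[OF mem(2,3) ad(1)] by auto
    ultimately show ?thesis by simp
  qed
  have same: "HZ d v * f v = HZ d w * f w"
    if d: "d \<in> checks n True" and ad: "adj n d v" "adj n d w" for d v w
  proof -
    obtain i j where ij: "d = node n (int i) (int j)" "even i = True" "odd j = True"
      using d by (rule checks_nodeE)
    let ?k = "int i" and ?l = "int j"
    define z where "z = HZ d (node n (?k + 1) ?l) * f (node n (?k + 1) ?l)"
    have "HZ d u * f u = z" if "adj n d u" for u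
    proof -
      have "u \<in> {node n (?k + 1) ?l, node n (?k + -1) ?l, node n ?k (?l + 1), node n ?k (?l + -1)}"
        using that by (auto simp: ij(1) adj_def nbrs_node[OF n0])
      \<comment> \<open>Three diagonal X-checks suffice to link all four neighbours of
        \<open>d\<close>.\<close>
      then show ?thesis
        using cross[of ?k ?l 1 1] cross[of ?k ?l "-1" 1] cross[of ?k ?l 1 "-1"] ij
        unfolding z_def by auto
    qed
    then show ?thesis using ad by simp
  qed
  have fnz: "f v \<noteq> 0" if v: "v \<in> ?V" for v
  proof -
    have "\<exists>c\<in>checks n False. adj n c v"
      using n0 v by (cases rule: Vnodes_cases[where s = False]) (use adj_node[OF n0] in blast)+
    then obtain c where "c \<in> checks n False" "adj n c v" by blast
    then show ?thesis using fac[of c v] HX v unfolding is_labeling_def by (metis mult_zero_right)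
  qed
  define g' where "g' = (\<lambda>d. let v = (SOME v. v \<in> ?V \<and> adj n d v) in HZ d v * f v)"
  have g': "g' d = HZ d v * f v" if "d \<in> checks n True" "v \<in> ?V" "adj n d v" for d v
  proof -
    define w where "w = (SOME v. v \<in> ?V \<and> adj n d v)"
    have "w \<in> ?V \<and> adj n d w" unfolding w_def by (rule someI[of _ v]) (use that in simp)
    then show ?thesis using same[of d w v] that unfolding g'_def w_def[symmetric] by simp
  qed
  show ?thesis
  proof (rule that[of g'])
    fix d assume d: "d \<in> checks n True"
    then obtain i j where ij: "d = node n (int i) (int j)" "even i = True" "odd j = True"
      by (rule checks_nodeE)
    let ?v = "node n (int i + 1) (int j)"
    have v: "?v \<in> ?V" "adj n d ?v" using ij n0 by (auto simp: node_in_Vnodes_iff)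
    then have "HZ d ?v \<noteq> 0" using HZ d unfolding is_labeling_def by blast
    then show "g' d \<noteq> 0" using g'[OF d v] fnz[OF v(1)] by simp
  next
    fix d v assume "d \<in> checks n True" "v \<in> ?V" "adj n d v"
    then show "HZ d v = g' d * inverse (f v)" using g'[of d v] fnz[of v] by simp
  qed
qed

theorem theorem1:
  fixes n m :: nat
    and HX HZ :: "pt \<Rightarrow> pt \<Rightarrow> 'a::{field, finite}"
    and b :: "nat \<Rightarrow> 'a"
  assumes "n \<ge> 2" and "m \<ge> 1" and "card (UNIV :: 'a set) = 2 ^ m"
    and "is_F2_basis m b"
    and "is_labeling n (CXnodes n) HX"
    and "is_labeling n (CZnodes n) HZ"
    and "\<forall>vs cs. is_cycle n (CXnodes n) vs cs \<longrightarrow> cycle_prod HX vs cs = 1"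
    and "dual (Vnodes n) (ker (CZnodes n) (Vnodes n) HZ) \<subseteq> ker (CXnodes n) (Vnodes n) HX"
  shows "int (dimF2 (ker (CXnodes n \<times> {..<m}) (Vnodes n \<times> {..<m}) (extX m b HX)))
       - int (dimF2 (dual (Vnodes n \<times> {..<m})
                  (ker (CZnodes n \<times> {..<m}) (Vnodes n \<times> {..<m}) (extZ m b HZ))))
       = 2 * int m"
proof -
  let ?V = "Vnodes n" and ?X = "checks n False" and ?Z = "checks n True"
  let ?q = "card (UNIV :: 'a set)"
  note n = assms(1) and q = assms(3) and basis = assms(4)
  have HX: "is_labeling n ?X HX" and HZ: "is_labeling n ?Z HZ"
    using assms(5,6) by (simp_all add: CXnodes_eq_checks CZnodes_eq_checks)
  have char2: "(1 + 1 :: 'a) = 0" using char_two_of_card[OF q] .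
  \<comment> \<open>Rows of \<open>HZ\<close> are orthogonal to the kernel of \<open>HZ\<close>, so
    by assumption they lie in the kernel of \<open>HX\<close>.\<close>
  have orth: "(\<Sum>v\<in>?V. HX c v * HZ d v) = 0" if c: "c \<in> ?X" and d: "d \<in> ?Z" for c d
  proof -
    have "(\<lambda>v. if v \<in> ?V then HZ d v else 0) \<in> ker ?X ?V HX"
      using row_in_row_space[of ?Z d ?V HZ] row_space_subset_dual_ker[of ?Z ?V HZ] d assms(8)
      by (auto simp: CXnodes_eq_checks CZnodes_eq_checks)
    then have "(\<Sum>v\<in>?V. HX c v * (if v \<in> ?V then HZ d v else 0)) = 0"
      using c unfolding ker_def by blast
    then show ?thesis by (simp cong: sum.cong)
  qed
  obtain g f where g: "\<And>c. c \<in> ?X \<Longrightarrow> g c \<noteq> 0"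
    and fac: "\<And>c v. c \<in> ?X \<Longrightarrow> v \<in> ?V \<Longrightarrow> adj n c v \<Longrightarrow> HX c v = g c * f v"
    using labeling_factorization[OF n HX] assms(7) unfolding CXnodes_eq_checks by blast
  obtain g' where g': "\<And>d. d \<in> ?Z \<Longrightarrow> g' d \<noteq> 0"
    and fac': "\<And>d v. d \<in> ?Z \<Longrightarrow> v \<in> ?V \<Longrightarrow> adj n d v \<Longrightarrow> HZ d v = g' d * inverse (f v)"
    using dual_labeling_factorization[OF char2 n HX HZ fac orth] by blast
  have rowX: "card (row_space ?X ?V HX) * ?q = ?q ^ (n * n)"
    using card_row_space_times_card_left_kernel[of ?X ?V HX]
      card_left_kernel_of_factorization[OF char2 n HX fac g] by (simp add: card_checks)
  \<comment> \<open>The same rank count applies to the Z-checks, with column factor 1/f.\<close>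
  have rowZ: "card (row_space ?Z ?V HZ) * ?q = ?q ^ (n * n)"
    using card_row_space_times_card_left_kernel[of ?Z ?V HZ]
      card_left_kernel_of_factorization[OF char2 n HZ fac' g'] by (simp add: card_checks)
  have kerX: "card (row_space ?X ?V HX) * card (ker ?X ?V HX) = ?q ^ (2 * (n * n))"
    using card_row_space_times_card_ker[of ?X ?V HX] by (simp add: card_Vnodes)
  let ?KX = "ker (?X \<times> {..<m}) (?V \<times> {..<m}) (extX m b HX)"
  let ?DZ = "dual (?V \<times> {..<m}) (ker (?Z \<times> {..<m}) (?V \<times> {..<m}) (extZ m b HZ))"
  have fin: "finite (vecs (?V \<times> {..<m}) :: (pt \<times> nat \<Rightarrow> bit) set)"
    by (rule card_vecs(2)) simp
  have "finite ?KX" "finite ?DZ"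
    by (rule finite_subset[OF _ fin]; force simp: ker_def dual_def)+
  then have dX: "2 ^ dimF2 ?KX = card ?KX" and dZ: "2 ^ dimF2 ?DZ = card ?DZ"
    using two_power_dimF2 subspace_ker subspace_dual by blast+
  have X: "2 ^ dimF2 ?KX = card (ker ?X ?V HX)"
    using dX card_ker_extX[OF basis char2] by simp
  have "?DZ = row_space (?Z \<times> {..<m}) (?V \<times> {..<m}) (extZ m b HZ)"
    by (rule dual_ker) simp_all
  then have Z: "2 ^ dimF2 ?DZ = card (row_space ?Z ?V HZ)"
    using dZ card_row_space_extZ[OF basis char2, of ?Z ?V HZ] by simp
  \<comment> \<open>Multiplying \<open>rowX\<close> by the kernel size and inserting
    \<open>kerX\<close> removes the unknown size of the row space.\<close>
  have "?q ^ (n * n) * card (ker ?X ?V HX) = ?q ^ (2 * (n * n)) * ?q"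
    unfolding rowX[symmetric] kerX[symmetric] by (simp only: mult_ac)
  then have "(2::nat) ^ (m * (n * n) + dimF2 ?KX) = 2 ^ (m * (2 * (n * n)) + m)"
    by (simp add: X[symmetric] q power_add power_mult)
  then have "m * (n * n) + dimF2 ?KX = m * (2 * (n * n)) + m" by (rule power_inject_exp[THEN iffD1, rotated]) simp
  moreover have "(2::nat) ^ (dimF2 ?DZ + m) = 2 ^ (m * (n * n))"
    using rowZ by (simp add: Z[symmetric] q power_add power_mult)
  then have "dimF2 ?DZ + m = m * (n * n)" by (rule power_inject_exp[THEN iffD1, rotated]) simp
  moreover have "m * (2 * (n * n)) = 2 * (m * (n * n))" by simp
  ultimately have "dimF2 ?KX = dimF2 ?DZ + 2 * m" by linarith
  then show ?thesis by (simp add: CXnodes_eq_checks CZnodes_eq_checks)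
qed

end
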